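(* Let $D=(d_1,\dots,d_n)\in\mathcal D^n$ be a dataset and let $f:\mathbb R^p\times\mathcal D\to\mathbb R$ be convex and continuously differentiable in its first argument, with $\|\nabla f(x,d)\|_2\le C$ for all $x\in\mathbb R^p$ and $d\in\mathcal D$, for some constant $C>0$. Fix $\lambda>0$, $\rho>0$, a mini-batch size $m\in\{1,\dots,n\}$, a number of iterations $T$, learning rates $\eta^0,\dots,\eta^{T-1}>0$, a noise level $\sigma>0$, and data-independent initial vectors $x^0,z^0,y^0\in\mathbb R^p$. Consider the randomized algorithm (ssADMM) which, for $k=0,1,\dots,T-1$: (i) samples a mini-batch $B_k$ of $m$ records from $D$ uniformly at random without replacement; (ii) computes $g_k=\frac1m\sum_{d\in B_k}\nabla f(x^k,d)$ and $\tilde g_k=g_k+\gamma_k$ with $\gamma_k\sim\mathcal N(0,\sigma^2 I_p)$ drawn independently; (iii) sets $x^{k+1}=\frac{1}{\rho+1/\eta^k}\left(-\tilde g_k-y^k+\rho z^k+x^k/\eta^k\right)$; (iv) sets $z^{k+1}=\mathcal S_{\lambda/\rho}(x^{k+1}+y^k/\rho)$, where $\mathcal S_t$ is the coordinatewise soft-thresholding operator $\mathcal S_t(w)_i=w_i-t$ if $w_i>t$, $w_i+t$ if $w_i<-t$, and $0$ otherwise; (v) sets $y^{k+1}=y^k+\rho(x^{k+1}-z^{k+1})$; and finally outputs $x^T$. Let $q=m/n$, and for integers $j\ge 2$ let $\epsilon(j)=\frac{j\,(2C/m)^2}{2\sigma^2}$. For integer $\alpha\ge2$ define $$\epsilon'(\alpha)=\frac{1}{\alpha-1}\log\Big(1+q^2\binom{\alpha}{2}\min\{4(e^{\epsilon(2)}-1),\,2e^{\epsilon(2)}\}+\sum_{j=3}^{\alpha}q^j\binom{\alpha}{j}2e^{(j-1)\epsilon(j)}\Big).$$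 Then for every integer $\alpha\ge 2$ this algorithm satisfies $(\alpha,\,T\epsilon'(\alpha))$-Rényi differential privacy.
   Context: Two datasets $D,D'\in\mathcal D^n$ are neighboring ($D\sim D'$) if $D'$ is obtained from $D$ by replacing one record with another element of $\mathcal D$. For $\alpha\in(1,\infty)$, the Rényi divergence of distributions $P,Q$ is $D_\alpha(P\|Q)=\frac{1}{\alpha-1}\log\mathbb E_{x\sim Q}\big[(P(x)/Q(x))^\alpha\big]$. A randomized mechanism $\mathcal M$ satisfies $(\alpha,\epsilon)$-Rényi differential privacy (RDP) if $D_\alpha(\mathcal M(D)\|\mathcal M(D'))\le\epsilon$ for every pair of neighboring datasets $D\sim D'$. *)

theory Defs
  imports "HOL-Probability.Probability"
begin

definition neighboring :: "nat \<Rightarrow> 'd list \<Rightarrow> 'd list \<Rightarrow> bool" where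
  "neighboring n D D' \<longleftrightarrow> length D = n \<and> length D' = n \<and>
     (\<exists>i<n. \<forall>j<n. j \<noteq> i \<longrightarrow> D ! j = D' ! j)"

definition renyi_divergence :: "real \<Rightarrow> 'a measure \<Rightarrow> 'a measure \<Rightarrow> ereal" where
  "renyi_divergence \<alpha> P Q =
    (if sets P = sets Q \<and> absolutely_continuous Q P then
       (let I = (\<integral>\<^sup>+ x. ennreal ((enn2real (RN_deriv Q P x)) powr \<alpha>) \<partial>Q)
        in if I = \<infinity> then \<infinity> else ereal (ln (enn2real I) / (\<alpha> - 1)))
     else \<infinity>)"

definition renyi_dp :: "nat \<Rightarrow> ('d list \<Rightarrow> 'b measure) \<Rightarrow> real \<Rightarrow> real \<Rightarrow> bool" where
  "renyi_dp n M \<alpha> \<epsilon> \<longleftrightarrow>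
     (\<forall>D D'. neighboring n D D' \<longrightarrow> renyi_divergence \<alpha> (M D) (M D') \<le> ereal \<epsilon>)"

definition soft_threshold :: "real \<Rightarrow> real ^ 'p \<Rightarrow> real ^ 'p" where
  "soft_threshold t w = (\<chi> i. if w $ i > t then w $ i - t
                               else if w $ i < - t then w $ i + t else 0)"

definition gaussian_vec :: "real \<Rightarrow> (real ^ 'p) measure" where
  "gaussian_vec \<sigma> = density lborel (\<lambda>g. ennreal (\<Prod>i\<in>UNIV. normal_density 0 \<sigma> (g $ i)))"

definition batches :: "nat \<Rightarrow> nat \<Rightarrow> nat set set" where
  "batches n m = {B. B \<subseteq> {..<n} \<and> card B = m}"

definition ssadmm_step ::
  "'d list \<Rightarrow> (real ^ 'p \<Rightarrow> 'd \<Rightarrow> real ^ 'p) \<Rightarrow> nat \<Rightarrow> real \<Rightarrow> real \<Rightarrow> real \<Rightarrow>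
   nat set \<Rightarrow> real ^ 'p \<Rightarrow> ((real ^ 'p) \<times> (real ^ 'p) \<times> (real ^ 'p)) \<Rightarrow>
   ((real ^ 'p) \<times> (real ^ 'p) \<times> (real ^ 'p))" where
  "ssadmm_step D grad m lam \<rho> \<eta>k B \<gamma> s =
    (case s of (x, z, y) \<Rightarrow>
      (let g = (1 / real m) *\<^sub>R (\<Sum>i\<in>B. grad x (D ! i));
           gt = g + \<gamma>;
           x' = (1 / (\<rho> + 1 / \<eta>k)) *\<^sub>R (- gt - y + \<rho> *\<^sub>R z + (1 / \<eta>k) *\<^sub>R x);
           z' = soft_threshold (lam / \<rho>) (x' + (1 / \<rho>) *\<^sub>R y);
           y' = y + \<rho> *\<^sub>R (x' - z')
       in (x', z', y')))"

fun ssadmm_iter ::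
  "'d list \<Rightarrow> (real ^ 'p \<Rightarrow> 'd \<Rightarrow> real ^ 'p) \<Rightarrow> nat \<Rightarrow> real \<Rightarrow> real \<Rightarrow> (nat \<Rightarrow> real) \<Rightarrow>
   ((real ^ 'p) \<times> (real ^ 'p) \<times> (real ^ 'p)) \<Rightarrow> (nat \<Rightarrow> nat set \<times> (real ^ 'p)) \<Rightarrow> nat \<Rightarrow>
   ((real ^ 'p) \<times> (real ^ 'p) \<times> (real ^ 'p))" where
  "ssadmm_iter D grad m lam \<rho> \<eta> s0 \<omega> 0 = s0"
| "ssadmm_iter D grad m lam \<rho> \<eta> s0 \<omega> (Suc k) =
     ssadmm_step D grad m lam \<rho> (\<eta> k) (fst (\<omega> k)) (snd (\<omega> k))
       (ssadmm_iter D grad m lam \<rho> \<eta> s0 \<omega> k)"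

definition ssadmm ::
  "(real ^ 'p \<Rightarrow> 'd \<Rightarrow> real ^ 'p) \<Rightarrow> nat \<Rightarrow> nat \<Rightarrow> real \<Rightarrow> real \<Rightarrow> nat \<Rightarrow> (nat \<Rightarrow> real) \<Rightarrow>
   real \<Rightarrow> real ^ 'p \<Rightarrow> real ^ 'p \<Rightarrow> real ^ 'p \<Rightarrow> 'd list \<Rightarrow> (real ^ 'p) measure" where
  "ssadmm grad n m lam \<rho> T \<eta> \<sigma> x0 z0 y0 D =
     distr (PiM {..<T} (\<lambda>_. pair_measure (measure_pmf (pmf_of_set (batches n m))) (gaussian_vec \<sigma>)))
       borel (\<lambda>\<omega>. fst (ssadmm_iter D grad m lam \<rho> \<eta> (x0, z0, y0) \<omega> T))"

definition eps_j :: "real \<Rightarrow> nat \<Rightarrow> real \<Rightarrow> nat \<Rightarrow> real" where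
  "eps_j C m \<sigma> j = real j * (2 * C / real m)\<^sup>2 / (2 * \<sigma>\<^sup>2)"

definition eps_prime :: "real \<Rightarrow> nat \<Rightarrow> nat \<Rightarrow> real \<Rightarrow> nat \<Rightarrow> real" where
  "eps_prime C n m \<sigma> \<alpha> =
    (let q = real m / real n in
     1 / (real \<alpha> - 1) * ln (1 + q\<^sup>2 * real (\<alpha> choose 2) *
         min (4 * (exp (eps_j C m \<sigma> 2) - 1)) (2 * exp (eps_j C m \<sigma> 2))
       + (\<Sum>j = 3..\<alpha>. q ^ j * real (\<alpha> choose j) * 2 * exp ((real j - 1) * eps_j C m \<sigma> j))))"

end

theory Submission
  imports Defs
begin

text \<open>
  Release all the noisy gradients \<open>g + \<gamma>\<close>: the output is a data-independent function of them.
  Given the past, the law of a noisy gradient is a uniform mixture, over the batches, of Gaussians.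
  For neighbouring datasets differing at index \<open>i\<close>, the mixtures \<open>P\<close> and \<open>Q\<close> differ only in the
  batches containing \<open>i\<close>, so \<open>P - Q\<close> is \<open>q\<close> times an average of differences of Gaussians.
  Expand \<open>\<integral>(P/Q)\<^bsup>\<alpha>\<^esup> dQ\<close> binomially in \<open>(P - Q)/Q\<close>; the linear term vanishes.  For the others,
  couple a batch \<open>B\<close> containing \<open>i\<close> and an index \<open>l\<close> with the batch \<open>B\<close> if \<open>l \<in> B\<close> and with
  \<open>B - {i} + {l}\<close> otherwise: every batch arises from exactly \<open>m\<close> pairs, so \<open>Q\<close> is an average
  over pairs as well.  Joint convexity of \<open>a\<^sup>j / r\<^bsup>j-1\<^esup>\<close> reduces the estimate to three Gaussians with
  means at mutual distance at most \<open>2C/m\<close>, where it is an explicit computation.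

  The \<open>T\<close> steps are composed using the Hoelder-dual form of the moment bound.
\<close>

section \<open>Power inequalities\<close>

text \<open>The tangent of the convex function \<open>u ^ Suc k\<close> at \<open>u = v\<close>
  stays below it. The induction multiplies the previous inequality by \<open>v\<close> and adds
  \<open>(u ^ Suc k - v ^ Suc k) * (u - v)\<close>, a product of factors of equal sign. Both the
  joint convexity and the Hoelder inequality below rest on it.\<close>

lemma young_power:
  fixes u v :: real
  assumes "u \<ge> 0" "v \<ge> 0"
  shows "real (Suc k) * v ^ k * u \<le> real k * v ^ Suc k + u ^ Suc k"
proof (induction k)
  case (Suc k)
  have "0 \<le> (u ^ Suc k - v ^ Suc k) * (u - v)"
  proof (cases "u \<le> v")
    case True
    then have "u ^ Suc k \<le> v ^ Suc k" using assms by (intro power_mono)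
    with True show ?thesis by (intro mult_nonpos_nonpos) auto
  next
    case False
    then have "v ^ Suc k \<le> u ^ Suc k" using assms by (intro power_mono) auto
    with False show ?thesis by (intro mult_nonneg_nonneg) auto
  qed
  moreover have "v * (real (Suc k) * v ^ k * u) \<le> v * (real k * v ^ Suc k + u ^ Suc k)"
    using Suc assms by (intro mult_left_mono)
  ultimately show ?case by (simp add: algebra_simps)
qed (use assms in auto)

text \<open>The map \<open>(a, r)\<close> to \<open>a ^ Suc k / r ^ k\<close> is the perspective of
  a convex power: jointly convex and homogeneous of degree one, hence subadditive.\<close>

lemma perspective_sum_power:
  fixes a r :: "'i \<Rightarrow> real"
  assumes "\<And>i. i \<in> I \<Longrightarrow> a i \<ge> 0" "\<And>i. i \<in> I \<Longrightarrow> r i > 0"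
  shows "(\<Sum>i\<in>I. a i) ^ Suc k / (\<Sum>i\<in>I. r i) ^ k \<le> (\<Sum>i\<in>I. a i ^ Suc k / r i ^ k)"
proof (cases "finite I \<and> I \<noteq> {}")
  case True
  \<comment> \<open>All ratios \<open>a i / r i\<close> are compared with the tangent at the common
    point \<open>t\<close>; after weighting by \<open>r i\<close> and summing, the tangent values
    add up to exactly \<open>A ^ Suc k / R ^ k\<close>.\<close>
  define A R t where "A = sum a I" and "R = sum r I" and "t = A / R"
  have R: "R > 0" and A: "A \<ge> 0"
    unfolding R_def A_def using True assms by (auto intro!: sum_pos sum_nonneg)
  have t: "t \<ge> 0" using R A by (simp add: t_def)
  have *: "real (Suc k) * t ^ k * a i - real k * t ^ Suc k * r i \<le> a i ^ Suc k / r i ^ k" if "i \<in> I" for i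
  proof -
    have r: "r i > 0" using assms that by auto
    have "r i * (real (Suc k) * t ^ k * (a i / r i)) \<le> r i * (real k * t ^ Suc k + (a i / r i) ^ Suc k)"
      using r t assms(1)[OF that] by (intro mult_left_mono young_power) auto
    moreover have "r i * (a i / r i) ^ Suc k = a i ^ Suc k / r i ^ k"
      using r by (simp add: power_divide)
    moreover have "r i * (real (Suc k) * t ^ k * (a i / r i)) = real (Suc k) * t ^ k * a i"
      using r by simp
    ultimately show ?thesis by (simp add: algebra_simps)
  qed
  have "A ^ Suc k / R ^ k = t ^ k * A"
    by (simp add: t_def power_divide)
  also have "\<dots> = real (Suc k) * t ^ k * A - real k * t ^ Suc k * R"
    using R by (simp add: t_def algebra_simps)
  also have "\<dots> = (\<Sum>i\<in>I. real (Suc k) * t ^ k * a i - real k * t ^ Suc k * r i)"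
    by (simp add: A_def R_def sum_distrib_left sum_subtractf)
  also have "\<dots> \<le> (\<Sum>i\<in>I. a i ^ Suc k / r i ^ k)"
    by (intro sum_mono *)
  finally show ?thesis by (simp add: A_def R_def)
\<comment> \<open>An infinite or empty index set makes every sum 0, and
  \<open>0 ^ Suc k = 0\<close>.\<close>
qed auto

text \<open>Binomial expansion of \<open>Q * (1 + (P - Q) / Q) ^ \<alpha>\<close>, with absolute
  values taken only from order 2 on. The negative part of the linear term stands on the left, so
  that for nonnegative \<open>P\<close> both sides can be integrated in \<open>ennreal\<close>
  without subtraction.\<close>

lemma power_ratio_le_binomial:
  fixes P Q :: real
  assumes "Q > 0" "\<alpha> \<ge> 2"
  shows "P ^ \<alpha> / Q ^ (\<alpha> - 1) + real \<alpha> * Q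
    \<le> Q + real \<alpha> * P + (\<Sum>j = 2..\<alpha>. real (\<alpha> choose j) * (\<bar>P - Q\<bar> ^ j / Q ^ (j - 1)))"
proof -
  have "P ^ \<alpha> / Q ^ (\<alpha> - 1) = Q * (((P - Q) / Q + 1) ^ \<alpha>)"
    using assms by (cases \<alpha>) (auto simp: field_simps power_divide)
  also have "\<dots> = (\<Sum>j\<le>\<alpha>. real (\<alpha> choose j) * (Q * ((P - Q) / Q) ^ j))"
    by (simp add: binomial_ring sum_distrib_left mult_ac)
  also have "{..\<alpha>} = insert 0 (insert 1 {2..\<alpha>})"
    using assms by auto
  also have "(\<Sum>j\<in>\<dots>. real (\<alpha> choose j) * (Q * ((P - Q) / Q) ^ j)) =
      Q + real \<alpha> * (P - Q) + (\<Sum>j = 2..\<alpha>. real (\<alpha> choose j) * (Q * ((P - Q) / Q) ^ j))"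
    using assms by simp
  also have "(\<Sum>j = 2..\<alpha>. real (\<alpha> choose j) * (Q * ((P - Q) / Q) ^ j)) \<le>
      (\<Sum>j = 2..\<alpha>. real (\<alpha> choose j) * (\<bar>P - Q\<bar> ^ j / Q ^ (j - 1)))"
  proof (intro sum_mono mult_left_mono)
    fix j assume "j \<in> {2..\<alpha>}"
    then obtain k where j: "j = Suc k" by (cases j) auto
    have "Q * ((P - Q) / Q) ^ j = (P - Q) ^ j / Q ^ (j - 1)"
      using assms by (simp add: j power_divide)
    also have "\<dots> \<le> \<bar>P - Q\<bar> ^ j / Q ^ (j - 1)"
      using assms abs_ge_self[of "(P - Q) ^ j"] by (intro divide_right_mono) (auto simp: power_abs)
    finally show "Q * ((P - Q) / Q) ^ j \<le> \<dots>" .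
  qed auto
  finally show ?thesis by (simp add: algebra_simps)
qed

section \<open>Batches\<close>

definition swap_index :: "'a \<Rightarrow> 'a set \<Rightarrow> 'a \<Rightarrow> 'a set" where
  "swap_index i B l = (if l \<in> B then B else insert l (B - {i}))"

lemma finite_batches [simp]: "finite (batches n m)"
  unfolding batches_def by (rule finite_subset[of _ "Pow {..<n}"]) auto

lemma batches_nonempty: "m \<le> n \<Longrightarrow> batches n m \<noteq> {}"
  using card_lessThan[of m] by (auto simp: batches_def intro!: exI[of _ "{..<m}"])

lemma swap_index_in_batches:
  assumes "B \<in> batches n m" "i \<in> B" "l < n"
  shows "swap_index i B l \<in> batches n m"
proof -
  have fin: "finite B" using assms by (auto simp: batches_def intro: finite_subset)
  have "card B > 0" using fin assms by (auto simp: card_gt_0_iff)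
  then show ?thesis
    using assms fin by (auto simp: swap_index_def batches_def)
qed

text \<open>\<open>swap_index i B l\<close> always contains \<open>l\<close>, and it contains
  \<open>i\<close> exactly when it equals \<open>B\<close>. So the pairs \<open>(B, l)\<close>
  correspond one to one to batches with a chosen member, and each batch has \<open>m\<close> members
  to choose.\<close>

lemma sum_swap_index:
  fixes F :: "nat set \<Rightarrow> real"
  assumes "i < n"
  shows "(\<Sum>B\<in>{B\<in>batches n m. i \<in> B}. \<Sum>l<n. F (swap_index i B l)) = real m * (\<Sum>B\<in>batches n m. F B)"
proof -
  have fin: "finite B" if "B \<in> batches n m" for B
    using that by (auto simp: batches_def intro: finite_subset)
  have "(\<Sum>B\<in>{B\<in>batches n m. i \<in> B}. \<Sum>l<n. F (swap_index i B l)) =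
     (\<Sum>(B, l)\<in>(SIGMA B:{B\<in>batches n m. i \<in> B}. {..<n}). F (swap_index i B l))"
    by (subst sum.Sigma) auto
  also have "\<dots> = (\<Sum>(B, l)\<in>(SIGMA B:batches n m. B). F B)"
  \<comment> \<open>The inverse reads off from the presence of \<open>i\<close> which case of
    \<open>swap_index\<close> occurred, and in the second case exchanges \<open>l\<close> back for
    \<open>i\<close>.\<close>
  proof (rule sum.reindex_bij_witness[where
        i = "\<lambda>(B, l). (if i \<in> B then B else insert i (B - {l}), l)" and
        j = "\<lambda>(B, l). (swap_index i B l, l)"], goal_cases)
    case (1 a) then show ?case by (auto simp: swap_index_def split: if_splits)
  next
    case (2 a)
    then show ?case by (auto simp: swap_index_in_batches) (auto simp: swap_index_def)
  next
    case (3 a) then show ?case by (auto simp: swap_index_def split: if_splits)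
  next
    case (4 a)
    then obtain B l where a: "a = (B, l)" "B \<in> batches n m" "l \<in> B" by auto
    have "card B > 0" using a fin[of B] by (auto simp: card_gt_0_iff)
    then show ?case using a fin[of B] assms by (auto simp: batches_def)
  next
    case (5 a) then show ?case by auto
  qed
  also have "\<dots> = (\<Sum>B\<in>batches n m. \<Sum>l\<in>B. F B)"
    using fin by (subst sum.Sigma) auto
  also have "\<dots> = (\<Sum>B\<in>batches n m. real m * F B)"
    by (intro sum.cong) (auto simp: batches_def)
  finally show ?thesis by (simp add: sum_distrib_left)
qed

text \<open>The double count with a constant summand gives the inclusion probability
  \<open>m / n\<close> of a single record; this is the origin of the factor
  \<open>q\<close>.\<close>

lemma card_batches_containing:
  assumes "i < n"
  shows "real n * real (card {B\<in>batches n m. i \<in> B}) = real m * real (card (batches n m))"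
  using sum_swap_index[OF assms, where m = m and F = "\<lambda>_. 1"] by (simp add: mult.commute)

section \<open>Gaussian densities\<close>

text \<open>Written through the norm instead of the coordinatewise product of
  \<open>gaussian_vec\<close>, so that translation and completing the square act on whole
  vectors.\<close>

definition gauss_density :: "real \<Rightarrow> real ^ 'p \<Rightarrow> real ^ 'p \<Rightarrow> real" where
  "gauss_density \<sigma> v g = (1 / sqrt (2 * pi * \<sigma>\<^sup>2)) ^ CARD('p) * exp (- (norm (g - v))\<^sup>2 / (2 * \<sigma>\<^sup>2))"

lemma gauss_density_pos: "\<sigma> > 0 \<Longrightarrow> gauss_density \<sigma> v g > 0"
  by (simp add: gauss_density_def)

lemma borel_measurable_gauss_density [measurable]: "gauss_density \<sigma> v \<in> borel_measurable borel"
  unfolding gauss_density_def by measurable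

lemma prod_normal_density_eq_gauss_density:
  "(\<Prod>i\<in>UNIV. normal_density 0 \<sigma> ((g :: real ^ 'p) $ i)) = gauss_density \<sigma> 0 g"
  by (simp add: normal_density_def gauss_density_def prod_dividef exp_sum[symmetric] norm_vec_def
      L2_set_def sum_nonneg sum_negf sum_divide_distrib power_one_over divide_simps)

lemma nn_integral_lborel_translate:
  fixes f :: "'a :: euclidean_space \<Rightarrow> ennreal"
  assumes [measurable]: "f \<in> borel_measurable borel"
  shows "(\<integral>\<^sup>+ x. f (v + x) \<partial>lborel) = (\<integral>\<^sup>+ x. f x \<partial>lborel)"
proof -
  have "(\<integral>\<^sup>+ x. f x \<partial>lborel) = (\<integral>\<^sup>+ x. f x \<partial>distr lborel borel ((+) v))"
    by (simp add: lborel_distr_plus)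
  also have "\<dots> = (\<integral>\<^sup>+ x. f (v + x) \<partial>lborel)"
    by (subst nn_integral_distr) auto
  finally show ?thesis by simp
qed

lemma nn_integral_gauss_density [simp]:
  fixes v :: "real ^ 'p"
  assumes "\<sigma> > 0"
  shows "(\<integral>\<^sup>+ g. ennreal (gauss_density \<sigma> v g) \<partial>lborel) = 1"
proof -
  \<comment> \<open>The product over coordinates is reindexed by the standard basis, the form in
    which the integral over \<open>lborel\<close> factorizes.\<close>
  have basis: "(Basis :: (real ^ 'p) set) = (\<lambda>i. axis i 1) ` UNIV"
    by (auto simp: Basis_vec_def)
  have inj: "inj (\<lambda>i :: 'p. axis i (1 :: real))"
    by (auto simp: inj_on_def axis_eq_axis)
  have "(\<integral>\<^sup>+ g. ennreal (gauss_density \<sigma> v g) \<partial>lborel) =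
      (\<integral>\<^sup>+ g. ennreal (gauss_density \<sigma> v (v + g)) \<partial>lborel)"
    by (rule nn_integral_lborel_translate[symmetric]) measurable
  also have "\<dots> = (\<integral>\<^sup>+ g. ennreal (gauss_density \<sigma> 0 (g :: real ^ 'p)) \<partial>lborel)"
    by (simp add: gauss_density_def)
  also have "\<dots> = (\<integral>\<^sup>+ g. (\<Prod>b\<in>Basis. ennreal (normal_density 0 \<sigma> ((g :: real ^ 'p) \<bullet> b))) \<partial>lborel)"
    by (simp add: prod_normal_density_eq_gauss_density[symmetric] basis prod.reindex[OF inj]
        inner_axis prod_ennreal)
  also have "\<dots> = (\<Prod>b\<in>(Basis :: (real ^ 'p) set). \<integral>\<^sup>+ x. ennreal (normal_density 0 \<sigma> x) \<partial>lborel)"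
    by (rule nn_integral_lborel_prod) auto
  also have "(\<integral>\<^sup>+ x. ennreal (normal_density 0 \<sigma> x) \<partial>lborel) = 1"
    using assms by (subst nn_integral_eq_integral) (auto intro: integrable_normal_moment)
  finally show ?thesis by simp
qed

text \<open>Completing the square: the tilted density is again Gaussian, centred at \<open>j a - (j - 1) b\<close>.\<close>

lemma gauss_density_power_ratio:
  fixes a b g :: "real ^ 'p"
  assumes "\<sigma> > 0"
  shows "gauss_density \<sigma> a g ^ Suc k / gauss_density \<sigma> b g ^ k =
    exp (real (Suc k) * real k * (norm (a - b))\<^sup>2 / (2 * \<sigma>\<^sup>2)) *
    gauss_density \<sigma> (real (Suc k) *\<^sub>R a - real k *\<^sub>R b) g"
proof -
  define v where "v = real (Suc k) *\<^sub>R a - real k *\<^sub>R b"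
  have *: "real (Suc k) * (norm (g - a))\<^sup>2 - real k * (norm (g - b))\<^sup>2 =
      (norm (g - v))\<^sup>2 - real (Suc k) * real k * (norm (a - b))\<^sup>2"
    unfolding v_def power2_norm_eq_inner
    by (simp add: inner_diff_left inner_diff_right inner_commute algebra_simps power2_eq_square)
  define c where "c = (1 / sqrt (2 * pi * \<sigma>\<^sup>2)) ^ CARD('p)"
  have c: "c > 0" using assms by (simp add: c_def)
  have "gauss_density \<sigma> a g ^ Suc k / gauss_density \<sigma> b g ^ k =
      c * (exp (real (Suc k) * (- (norm (g - a))\<^sup>2 / (2 * \<sigma>\<^sup>2))) /
        exp (real k * (- (norm (g - b))\<^sup>2 / (2 * \<sigma>\<^sup>2))))"
    unfolding gauss_density_def c_def[symmetric] power_mult_distrib exp_of_nat_mult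
    using c by simp
  also have "exp (real (Suc k) * (- (norm (g - a))\<^sup>2 / (2 * \<sigma>\<^sup>2))) /
        exp (real k * (- (norm (g - b))\<^sup>2 / (2 * \<sigma>\<^sup>2))) =
      exp (- (real (Suc k) * (norm (g - a))\<^sup>2 - real k * (norm (g - b))\<^sup>2) / (2 * \<sigma>\<^sup>2))"
    unfolding exp_diff[symmetric] by (simp add: diff_divide_distrib)
  also have "\<dots> = exp (real (Suc k) * real k * (norm (a - b))\<^sup>2 / (2 * \<sigma>\<^sup>2)) *
      exp (- (norm (g - v))\<^sup>2 / (2 * \<sigma>\<^sup>2))"
    unfolding * exp_add[symmetric] by (simp add: diff_divide_distrib)
  moreover have "gauss_density \<sigma> v g = c * exp (- (norm (g - v))\<^sup>2 / (2 * \<sigma>\<^sup>2))"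
    by (simp add: gauss_density_def c_def)
  ultimately show ?thesis
    unfolding v_def[symmetric] by (simp only: mult_ac)
qed

text \<open>The tilted Gaussian integrates to 1, so only the exponential prefactor survives, and
  that grows with the distance of the means.\<close>

lemma nn_integral_gauss_density_power_ratio_le:
  fixes a b :: "real ^ 'p"
  assumes "\<sigma> > 0" "norm (a - b) \<le> \<Delta>"
  shows "(\<integral>\<^sup>+ g. ennreal (gauss_density \<sigma> a g ^ Suc k / gauss_density \<sigma> b g ^ k) \<partial>lborel)
    \<le> ennreal (exp (real (Suc k) * real k * \<Delta>\<^sup>2 / (2 * \<sigma>\<^sup>2)))"
proof -
  have "(norm (a - b))\<^sup>2 \<le> \<Delta>\<^sup>2" using assms by (intro power_mono) auto
  then have le: "real (Suc k) * real k * (norm (a - b))\<^sup>2 / (2 * \<sigma>\<^sup>2) \<le> real (Suc k) * real k * \<Delta>\<^sup>2 / (2 * \<sigma>\<^sup>2)"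
    by (intro divide_right_mono mult_left_mono) auto
  have "(\<integral>\<^sup>+ g. ennreal (gauss_density \<sigma> a g ^ Suc k / gauss_density \<sigma> b g ^ k) \<partial>lborel)
      = ennreal (exp (real (Suc k) * real k * (norm (a - b))\<^sup>2 / (2 * \<sigma>\<^sup>2)))"
    unfolding gauss_density_power_ratio[OF assms(1)]
    using assms(1) by (simp add: ennreal_mult' nn_integral_cmult del: of_nat_Suc)
  then show ?thesis using le by (simp del: of_nat_Suc)
qed

section \<open>Differences of two Gaussian densities relative to a third\<close>

text \<open>The difference of two nonnegative numbers is at most their maximum, so its power is at
  most the sum of the two powers. Each summand contributes one Gaussian ratio moment, hence the
  factor 2.\<close>

lemma ternary_gauss_power_le:
  fixes a b c :: "real ^ 'p"
  assumes "\<sigma> > 0" "norm (a - c) \<le> \<Delta>" "norm (b - c) \<le> \<Delta>"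
  shows "(\<integral>\<^sup>+ g. ennreal (\<bar>gauss_density \<sigma> a g - gauss_density \<sigma> b g\<bar> ^ Suc k / gauss_density \<sigma> c g ^ k) \<partial>lborel)
    \<le> ennreal (2 * exp (real (Suc k) * real k * \<Delta>\<^sup>2 / (2 * \<sigma>\<^sup>2)))" (is "?L \<le> ennreal (2 * ?e)")
proof -
  note pos [simp] = gauss_density_pos[OF assms(1)]
  note nonneg [simp] = less_imp_le[OF gauss_density_pos[OF assms(1)]]
  have "?L \<le> (\<integral>\<^sup>+ g. ennreal (gauss_density \<sigma> a g ^ Suc k / gauss_density \<sigma> c g ^ k) +
      ennreal (gauss_density \<sigma> b g ^ Suc k / gauss_density \<sigma> c g ^ k) \<partial>lborel)"
  proof (rule nn_integral_mono)
    fix g :: "real ^ 'p"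
    let ?a = "gauss_density \<sigma> a g" and ?b = "gauss_density \<sigma> b g" and ?c = "gauss_density \<sigma> c g"
    have "\<bar>?a - ?b\<bar> ^ Suc k \<le> max ?a ?b ^ Suc k"
      using pos[of a g] pos[of b g] by (intro power_mono) (auto simp: max_def simp del: pos nonneg)
    also have "\<dots> \<le> ?a ^ Suc k + ?b ^ Suc k"
      by (auto simp: max_def simp del: power_Suc)
    finally have "\<bar>?a - ?b\<bar> ^ Suc k / ?c ^ k \<le> ?a ^ Suc k / ?c ^ k + ?b ^ Suc k / ?c ^ k"
      unfolding add_divide_distrib[symmetric] by (intro divide_right_mono) auto
    then show "ennreal (\<bar>?a - ?b\<bar> ^ Suc k / ?c ^ k) \<le> ennreal (?a ^ Suc k / ?c ^ k) + ennreal (?b ^ Suc k / ?c ^ k)"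
      by (subst ennreal_plus[symmetric]) (auto intro!: ennreal_leI simp del: ennreal_plus power_Suc)
  qed
  also have "\<dots> \<le> ennreal ?e + ennreal ?e"
    by (subst nn_integral_add) (auto intro!: add_mono nn_integral_gauss_density_power_ratio_le assms simp del: power_Suc of_nat_Suc)
  also have "\<dots> = ennreal (2 * ?e)"
    by (subst ennreal_plus[symmetric]) (auto simp del: ennreal_plus)
  finally show ?thesis .
qed

text \<open>With densities \<open>A\<close>, \<open>B\<close>, \<open>R\<close>, the square
  \<open>(A - B)\<^sup>2\<close> is at most
  \<open>2 * (A - R)\<^sup>2 + 2 * (B - R)\<^sup>2\<close>, the gap being
  \<open>(A + B - 2 * R)\<^sup>2\<close>. Divided by \<open>R\<close> and integrated, this is twice
  the sum of two chi-square divergences, each at most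
  \<open>exp (\<Delta>\<^sup>2 / \<sigma>\<^sup>2) - 1\<close>; unlike the cruder bound with factor
  2, it vanishes as \<Delta> tends to 0.\<close>

lemma ternary_gauss_square_le:
  fixes a b c :: "real ^ 'p"
  assumes "\<sigma> > 0" "norm (a - c) \<le> \<Delta>" "norm (b - c) \<le> \<Delta>"
  shows "(\<integral>\<^sup>+ g. ennreal (\<bar>gauss_density \<sigma> a g - gauss_density \<sigma> b g\<bar>\<^sup>2 / gauss_density \<sigma> c g) \<partial>lborel)
    \<le> ennreal (4 * (exp (\<Delta>\<^sup>2 / \<sigma>\<^sup>2) - 1))" (is "?L \<le> ennreal (4 * (?e - 1))")
proof -
  note pos [simp] = gauss_density_pos[OF assms(1)]
  note nonneg [simp] = less_imp_le[OF gauss_density_pos[OF assms(1)]]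
  have ratio: "(\<integral>\<^sup>+ g. ennreal ((gauss_density \<sigma> v g)\<^sup>2 / gauss_density \<sigma> c g) \<partial>lborel) \<le> ennreal ?e"
    if "norm (v - c) \<le> \<Delta>" for v
    using nn_integral_gauss_density_power_ratio_le[OF assms(1) that, of 1]
    by (simp add: numeral_2_eq_2)
  \<comment> \<open>The cross terms \<open>-4 * A * R\<close> and \<open>-4 * B * R\<close> become,
    after division by \<open>R\<close>, the integrals of \<open>4 * A\<close> and
    \<open>4 * B\<close>; they are moved to the left, where they amount to 8.\<close>
  have "?L + 8 = (\<integral>\<^sup>+ g. ennreal (\<bar>gauss_density \<sigma> a g - gauss_density \<sigma> b g\<bar>\<^sup>2 / gauss_density \<sigma> c g) +
      (4 * ennreal (gauss_density \<sigma> a g) + 4 * ennreal (gauss_density \<sigma> b g)) \<partial>lborel)"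
    using assms by (simp add: nn_integral_add nn_integral_cmult)
  also have "\<dots> \<le> (\<integral>\<^sup>+ g. 2 * ennreal ((gauss_density \<sigma> a g)\<^sup>2 / gauss_density \<sigma> c g) +
      2 * ennreal ((gauss_density \<sigma> b g)\<^sup>2 / gauss_density \<sigma> c g) + 4 * ennreal (gauss_density \<sigma> c g) \<partial>lborel)"
  proof (rule nn_integral_mono)
    fix g :: "real ^ 'p"
    define A B R where "A = gauss_density \<sigma> a g" and "B = gauss_density \<sigma> b g" and "R = gauss_density \<sigma> c g"
    have p: "A > 0" "B > 0" "R > 0" by (simp_all add: A_def B_def R_def)
    have "0 \<le> (A + B - 2 * R)\<^sup>2" by simp
    then have "\<bar>A - B\<bar>\<^sup>2 + 4 * A * R + 4 * B * R \<le> 2 * A\<^sup>2 + 2 * B\<^sup>2 + 4 * R\<^sup>2"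
      by (simp add: power2_eq_square algebra_simps)
    from divide_right_mono[OF this, of R] have "\<bar>A - B\<bar>\<^sup>2 / R + 4 * A + 4 * B \<le> 2 * (A\<^sup>2 / R) + 2 * (B\<^sup>2 / R) + 4 * R"
      using p by (simp add: add_divide_distrib power2_eq_square)
    then have "ennreal (\<bar>A - B\<bar>\<^sup>2 / R + (4 * A + 4 * B)) \<le> ennreal (2 * (A\<^sup>2 / R) + 2 * (B\<^sup>2 / R) + 4 * R)"
      by (intro ennreal_leI) simp
    then show "ennreal (\<bar>A - B\<bar>\<^sup>2 / R) + (4 * ennreal A + 4 * ennreal B) \<le>
       2 * ennreal (A\<^sup>2 / R) + 2 * ennreal (B\<^sup>2 / R) + 4 * ennreal R"
      using p by (simp add: ennreal_mult' del: times_divide_eq_right)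
  qed
  also have "\<dots> \<le> 2 * ennreal ?e + 2 * ennreal ?e + 4"
    using assms ratio[of a] ratio[of b]
    by (simp add: nn_integral_add nn_integral_cmult add_mono mult_left_mono)
  also have "\<dots> = ennreal (2 * ?e + 2 * ?e + 4)"
    by (simp add: ennreal_mult' flip: distrib_right)
  also have "\<dots> = ennreal (4 * (?e - 1)) + ennreal 8"
    by (subst ennreal_plus[symmetric]) (auto simp del: ennreal_plus)
  finally show ?thesis
    by (simp add: add.commute[of _ "8 :: ennreal"] ennreal_add_left_cancel_le)
qed

section \<open>Moments of subsampled Gaussian mixtures\<close>

text \<open>At \<open>\<Delta> = 2 * C / m\<close> this is the argument of the logarithm in
  \<open>eps_prime\<close>: there \<epsilon>(2) is
  \<open>\<Delta>\<^sup>2 / \<sigma>\<^sup>2\<close>, and (j - 1) \<epsilon>(j) is the exponent in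
  the sum.\<close>

definition subsampled_moment_bound :: "real \<Rightarrow> real \<Rightarrow> real \<Rightarrow> nat \<Rightarrow> real" where
  "subsampled_moment_bound q \<Delta> \<sigma> \<alpha> = 1 + q\<^sup>2 * real (\<alpha> choose 2) *
      min (4 * (exp (\<Delta>\<^sup>2 / \<sigma>\<^sup>2) - 1)) (2 * exp (\<Delta>\<^sup>2 / \<sigma>\<^sup>2))
    + (\<Sum>j = 3..\<alpha>. q ^ j * real (\<alpha> choose j) * 2 * exp (real j * (real j - 1) * \<Delta>\<^sup>2 / (2 * \<sigma>\<^sup>2)))"

definition mixture_density :: "real \<Rightarrow> nat \<Rightarrow> nat \<Rightarrow> (nat set \<Rightarrow> real ^ 'p) \<Rightarrow> real ^ 'p \<Rightarrow> real" where
  "mixture_density \<sigma> n m u g = (\<Sum>B\<in>batches n m. gauss_density \<sigma> (u B) g) / real (card (batches n m))"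

lemma borel_measurable_mixture_density [measurable]:
  "mixture_density \<sigma> n m u \<in> borel_measurable borel"
  unfolding mixture_density_def by measurable

lemma mixture_density_pos:
  assumes "\<sigma> > 0" "m \<le> n"
  shows "mixture_density \<sigma> n m u g > 0"
  unfolding mixture_density_def using assms batches_nonempty[OF assms(2)]
  by (intro divide_pos_pos sum_pos gauss_density_pos) (auto simp: card_gt_0_iff)

lemma nn_integral_mixture_density_mult:
  fixes f :: "real ^ 'p \<Rightarrow> ennreal"
  assumes [measurable]: "f \<in> borel_measurable borel" and "\<sigma> > 0" "m \<le> n"
  shows "(\<integral>\<^sup>+ g. ennreal (mixture_density \<sigma> n m u g) * f g \<partial>lborel) =
    (\<Sum>B\<in>batches n m. \<integral>\<^sup>+ g. ennreal (gauss_density \<sigma> (u B) g) * f g \<partial>lborel) / real (card (batches n m))"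
proof -
  note nonneg [simp] = less_imp_le[OF gauss_density_pos[OF assms(2)]]
  have "(\<integral>\<^sup>+ g. ennreal (mixture_density \<sigma> n m u g) * f g \<partial>lborel) =
     (\<integral>\<^sup>+ g. ennreal (1 / real (card (batches n m))) *
        (\<Sum>B\<in>batches n m. ennreal (gauss_density \<sigma> (u B) g) * f g) \<partial>lborel)"
    by (intro nn_integral_cong)
       (simp add: mixture_density_def sum_distrib_right[symmetric] sum_ennreal ennreal_mult'[symmetric]
         mult.assoc[symmetric])
  also have "\<dots> = ennreal (1 / real (card (batches n m))) *
     (\<Sum>B\<in>batches n m. \<integral>\<^sup>+ g. ennreal (gauss_density \<sigma> (u B) g) * f g \<partial>lborel)"
    by (simp add: nn_integral_cmult nn_integral_sum)
  also have "ennreal (1 / real (card (batches n m))) = inverse (ennreal (real (card (batches n m))))"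
    using batches_nonempty[OF assms(3)] by (subst inverse_ennreal) (auto simp: card_gt_0_iff divide_inverse)
  finally show ?thesis
    by (simp add: divide_ennreal_def mult.commute)
qed

lemma nn_integral_mixture_density:
  fixes u :: "nat set \<Rightarrow> real ^ 'p"
  assumes "\<sigma> > 0" "m \<le> n"
  shows "(\<integral>\<^sup>+ g. ennreal (mixture_density \<sigma> n m u g) \<partial>lborel) = 1"
proof -
  have "batches n m \<noteq> {}"
    by (rule batches_nonempty[OF assms(2)])
  then show ?thesis
    using nn_integral_mixture_density_mult[of "\<lambda>_. 1 :: ennreal" \<sigma> m n u] assms
    by (simp add: ennreal_of_nat_eq_real_of_nat divide_ennreal)
qed

text \<open>Over the same \<open>m * N\<close> pairs \<open>(B, l)\<close>, with \<open>N\<close>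
  the number of batches, the second mixture is an average and the difference of the mixtures is
  bounded by \<open>q\<close> times an average. Joint convexity then moves the averaging outside the
  ratio, so a bound \<open>Z\<close> uniform over single triples of Gaussians suffices.\<close>

lemma subsampled_difference_power_le:
  fixes u u' :: "nat set \<Rightarrow> real ^ 'p"
  assumes \<sigma>: "\<sigma> > 0" and m: "1 \<le> m" "m \<le> n" and i: "i < n"
    and same: "\<And>B. B \<in> batches n m \<Longrightarrow> i \<notin> B \<Longrightarrow> u B = u' B"
    and Z: "\<And>B l. B \<in> batches n m \<Longrightarrow> i \<in> B \<Longrightarrow> l < n \<Longrightarrow>
      (\<integral>\<^sup>+ g. ennreal (\<bar>gauss_density \<sigma> (u B) g - gauss_density \<sigma> (u' B) g\<bar> ^ Suc k /
         gauss_density \<sigma> (u' (swap_index i B l)) g ^ k) \<partial>lborel) \<le> ennreal Z"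
    and Z0: "Z \<ge> 0"
  shows "(\<integral>\<^sup>+ g. ennreal (\<bar>mixture_density \<sigma> n m u g - mixture_density \<sigma> n m u' g\<bar> ^ Suc k /
         mixture_density \<sigma> n m u' g ^ k) \<partial>lborel) \<le> ennreal ((real m / real n) ^ Suc k * Z)"
proof -
  define N where "N = real (card (batches n m))"
  define S where "S = {B \<in> batches n m. i \<in> B}"
  define a where "a = (\<lambda>g B. \<bar>gauss_density \<sigma> (u B) g - gauss_density \<sigma> (u' B) g\<bar>)"
  define r where "r = (\<lambda>g B l. gauss_density \<sigma> (u' (swap_index i B l)) g)"
  define q where "q = real m / real n"
  have N: "N > 0" using batches_nonempty[OF m(2)] by (auto simp: N_def card_gt_0_iff)
  have finS: "finite S" by (simp add: S_def)
  have q: "q > 0" using m by (simp add: q_def)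
  have Ni: "real n * real (card S) = real m * N"
    using card_batches_containing[OF i, of m] by (simp add: S_def N_def)
  have nN: "real m * N > 0" using m N by simp
  have r_pos: "r g B l > 0" for g B l using gauss_density_pos[OF \<sigma>] by (simp add: r_def)
  have meas [measurable]: "(\<lambda>g. a g B) \<in> borel_measurable borel" "(\<lambda>g. r g B l) \<in> borel_measurable borel" for B l
    unfolding a_def r_def by measurable
  have pt: "\<bar>mixture_density \<sigma> n m u g - mixture_density \<sigma> n m u' g\<bar> ^ Suc k / mixture_density \<sigma> n m u' g ^ k
      \<le> q ^ Suc k / (real m * N) * (\<Sum>(B, l)\<in>S \<times> {..<n}. a g B ^ Suc k / r g B l ^ k)" for g
  proof -
    have "mixture_density \<sigma> n m u g - mixture_density \<sigma> n m u' g =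
        (\<Sum>B\<in>batches n m. gauss_density \<sigma> (u B) g - gauss_density \<sigma> (u' B) g) / N"
      by (simp add: mixture_density_def N_def sum_subtractf diff_divide_distrib)
    also have "(\<Sum>B\<in>batches n m. gauss_density \<sigma> (u B) g - gauss_density \<sigma> (u' B) g) =
        (\<Sum>B\<in>S. gauss_density \<sigma> (u B) g - gauss_density \<sigma> (u' B) g)"
      by (rule sum.mono_neutral_right) (auto simp: S_def same)
    finally have "\<bar>mixture_density \<sigma> n m u g - mixture_density \<sigma> n m u' g\<bar> =
        \<bar>\<Sum>B\<in>S. gauss_density \<sigma> (u B) g - gauss_density \<sigma> (u' B) g\<bar> / N"
      using N by simp
    also have "\<dots> \<le> (\<Sum>B\<in>S. a g B) / N"
      unfolding a_def using N by (intro divide_right_mono sum_abs) auto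
    \<comment> \<open>\<open>a\<close> ignores \<open>l\<close>, so summing over \<open>l\<close>
      multiplies by \<open>n\<close>; the factor \<open>q\<close> compensates for replacing the
      normalization \<open>N\<close> by the number \<open>m * N\<close> of pairs, which
      \<open>mix\<close> uses as well.\<close>
    also have "\<dots> = q * ((\<Sum>(B, l)\<in>S \<times> {..<n}. a g B) / (real m * N))"
      using m by (simp add: q_def sum.cartesian_product[symmetric] sum_distrib_left[symmetric])
    finally have diff: "\<bar>mixture_density \<sigma> n m u g - mixture_density \<sigma> n m u' g\<bar> \<le>
        q * ((\<Sum>(B, l)\<in>S \<times> {..<n}. a g B) / (real m * N))" .
    have "(\<Sum>(B, l)\<in>S \<times> {..<n}. r g B l) = real m * (\<Sum>B\<in>batches n m. gauss_density \<sigma> (u' B) g)"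
      using sum_swap_index[OF i, of "\<lambda>B. gauss_density \<sigma> (u' B) g" m]
      by (simp add: r_def S_def sum.cartesian_product[symmetric])
    then have mix: "mixture_density \<sigma> n m u' g = (\<Sum>(B, l)\<in>S \<times> {..<n}. r g B l) / (real m * N)"
      using m by (simp add: mixture_density_def N_def)
    have "\<bar>mixture_density \<sigma> n m u g - mixture_density \<sigma> n m u' g\<bar> ^ Suc k / mixture_density \<sigma> n m u' g ^ k
       \<le> (q * ((\<Sum>(B, l)\<in>S \<times> {..<n}. a g B) / (real m * N))) ^ Suc k / mixture_density \<sigma> n m u' g ^ k"
      by (intro divide_right_mono power_mono diff) (auto intro!: zero_le_power less_imp_le[OF mixture_density_pos] \<sigma> m)
    also have "\<dots> = q ^ Suc k / (real m * N) *
        ((\<Sum>(B, l)\<in>S \<times> {..<n}. a g B) ^ Suc k / (\<Sum>(B, l)\<in>S \<times> {..<n}. r g B l) ^ k)"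
      unfolding mix using nN by (simp add: power_mult_distrib power_divide)
    also have "\<dots> \<le> q ^ Suc k / (real m * N) * (\<Sum>(B, l)\<in>S \<times> {..<n}. a g B ^ Suc k / r g B l ^ k)"
      using perspective_sum_power[of "S \<times> {..<n}" "\<lambda>(B, l). a g B" "\<lambda>(B, l). r g B l" k] r_pos q nN
      by (intro mult_left_mono) (auto simp: case_prod_unfold a_def simp del: power_Suc)
    finally show ?thesis .
  qed
  have "(\<integral>\<^sup>+ g. ennreal (\<bar>mixture_density \<sigma> n m u g - mixture_density \<sigma> n m u' g\<bar> ^ Suc k /
         mixture_density \<sigma> n m u' g ^ k) \<partial>lborel) \<le>
      (\<integral>\<^sup>+ g. ennreal (q ^ Suc k / (real m * N)) * (\<Sum>(B, l)\<in>S \<times> {..<n}. ennreal (a g B ^ Suc k / r g B l ^ k)) \<partial>lborel)"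
  proof (rule nn_integral_mono)
    fix g :: "real ^ 'p"
    have "(\<Sum>(B, l)\<in>S \<times> {..<n}. ennreal (a g B ^ Suc k / r g B l ^ k)) =
       ennreal (\<Sum>(B, l)\<in>S \<times> {..<n}. a g B ^ Suc k / r g B l ^ k)"
      using r_pos by (auto simp: case_prod_unfold a_def less_imp_le intro!: sum_ennreal)
    then show "ennreal (\<bar>mixture_density \<sigma> n m u g - mixture_density \<sigma> n m u' g\<bar> ^ Suc k /
         mixture_density \<sigma> n m u' g ^ k) \<le> ennreal (q ^ Suc k / (real m * N)) *
         (\<Sum>(B, l)\<in>S \<times> {..<n}. ennreal (a g B ^ Suc k / r g B l ^ k))"
      using pt[of g] q nN by (simp add: ennreal_mult'[symmetric] ennreal_leI del: power_Suc)
  qed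
  also have "\<dots> = ennreal (q ^ Suc k / (real m * N)) *
      (\<Sum>(B, l)\<in>S \<times> {..<n}. \<integral>\<^sup>+ g. ennreal (a g B ^ Suc k / r g B l ^ k) \<partial>lborel)"
    by (simp add: nn_integral_cmult nn_integral_sum case_prod_unfold del: power_Suc)
  also have "\<dots> \<le> ennreal (q ^ Suc k / (real m * N)) * (\<Sum>(B, l)\<in>S \<times> {..<n}. ennreal Z)"
    using Z by (intro mult_left_mono sum_mono) (auto simp: S_def a_def r_def simp del: power_Suc)
  also have "\<dots> = ennreal (q ^ Suc k / (real m * N) * (real (card S * n) * Z))"
  proof -
    have "q ^ Suc k / (real m * N) \<ge> 0" using q nN by (auto intro!: divide_nonneg_pos)
    then show ?thesis
      unfolding case_prod_unfold sum_constant card_cartesian_product card_lessThan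
        ennreal_of_nat_eq_real_of_nat by (simp only: ennreal_mult' of_nat_0_le_iff)
  qed
  \<comment> \<open>The number \<open>card S * n\<close> of pairs is \<open>m * N\<close> by
    \<open>Ni\<close> and cancels.\<close>
  also have "q ^ Suc k / (real m * N) * (real (card S * n) * Z) = q ^ Suc k * Z"
    using m N Ni by (simp add: mult_ac)
  finally show ?thesis by (simp add: q_def)
qed

text \<open>The binomial bound is integrated term by term. Since both mixtures have total mass 1,
  the linear contributions on the two sides are both \<alpha> and cancel; each order
  \<open>j\<close> from 2 on costs \<open>q ^ j * Z j\<close>.\<close>

lemma subsampled_moment_le:
  fixes u u' :: "nat set \<Rightarrow> real ^ 'p"
  assumes \<sigma>: "\<sigma> > 0" and m: "1 \<le> m" "m \<le> n" and i: "i < n" and \<alpha>: "\<alpha> \<ge> 2"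
    and same: "\<And>B. B \<in> batches n m \<Longrightarrow> i \<notin> B \<Longrightarrow> u B = u' B"
    and close: "\<And>B l. B \<in> batches n m \<Longrightarrow> i \<in> B \<Longrightarrow> l < n \<Longrightarrow> norm (u B - u' (swap_index i B l)) \<le> \<Delta>"
      "\<And>B l. B \<in> batches n m \<Longrightarrow> i \<in> B \<Longrightarrow> l < n \<Longrightarrow> norm (u' B - u' (swap_index i B l)) \<le> \<Delta>"
  shows "(\<integral>\<^sup>+ g. ennreal (mixture_density \<sigma> n m u g ^ \<alpha> / mixture_density \<sigma> n m u' g ^ (\<alpha> - 1)) \<partial>lborel)
    \<le> ennreal (subsampled_moment_bound (real m / real n) \<Delta> \<sigma> \<alpha>)"
proof -
  define P where "P = mixture_density \<sigma> n m u"
  define Q where "Q = mixture_density \<sigma> n m u'"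
  define q where "q = real m / real n"
  define D where "D = (\<lambda>j g. \<bar>P g - Q g\<bar> ^ j / Q g ^ (j - 1))"
  define e where "e = (\<lambda>j. 2 * exp (real j * (real j - 1) * \<Delta>\<^sup>2 / (2 * \<sigma>\<^sup>2)))"
  define e2 where "e2 = min (4 * (exp (\<Delta>\<^sup>2 / \<sigma>\<^sup>2) - 1)) (2 * exp (\<Delta>\<^sup>2 / \<sigma>\<^sup>2))"
  \<comment> \<open>Only order 2 has two competing estimates; the second argument of the minimum in
    \<open>e2\<close> is \<open>e 2\<close>.\<close>
  define Z where "Z = (\<lambda>j. if j = 2 then e2 else e j)"
  have [measurable]: "P \<in> borel_measurable borel" "Q \<in> borel_measurable borel"
    unfolding P_def Q_def by measurable
  have [measurable]: "D j \<in> borel_measurable borel" for j unfolding D_def by measurable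
  have pos: "P g > 0" "Q g > 0" for g unfolding P_def Q_def using mixture_density_pos \<sigma> m by auto
  have int: "(\<integral>\<^sup>+ g. ennreal (P g) \<partial>lborel) = 1" "(\<integral>\<^sup>+ g. ennreal (Q g) \<partial>lborel) = 1"
    unfolding P_def Q_def using nn_integral_mixture_density \<sigma> m by auto
  have D_nonneg: "D j g \<ge> 0" for j g using pos[of g] by (simp add: D_def)
  have Z_nonneg: "Z j \<ge> 0" for j by (auto simp: Z_def e_def e2_def)
  have D_le: "(\<integral>\<^sup>+ g. ennreal (D j g) \<partial>lborel) \<le> ennreal (q ^ j * Z j)" if "j \<in> {2..\<alpha>}" for j
  proof -
    obtain k where j: "j = Suc k" using \<open>j \<in> {2..\<alpha>}\<close> by (cases j) auto
    show ?thesis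
      unfolding D_def P_def Q_def j diff_Suc_1 q_def
    proof (rule subsampled_difference_power_le[OF \<sigma> m i same])
      fix B l assume B: "B \<in> batches n m" "i \<in> B" "l < n"
      have 1: "(\<integral>\<^sup>+ g. ennreal (\<bar>gauss_density \<sigma> (u B) g - gauss_density \<sigma> (u' B) g\<bar> ^ Suc k /
         gauss_density \<sigma> (u' (swap_index i B l)) g ^ k) \<partial>lborel) \<le> ennreal (e (Suc k))"
        using ternary_gauss_power_le[OF \<sigma> close(1)[OF B] close(2)[OF B], of k] by (simp add: e_def)
      show "(\<integral>\<^sup>+ g. ennreal (\<bar>gauss_density \<sigma> (u B) g - gauss_density \<sigma> (u' B) g\<bar> ^ Suc k /
         gauss_density \<sigma> (u' (swap_index i B l)) g ^ k) \<partial>lborel) \<le> ennreal (Z (Suc k))"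
      proof (cases "k = 1")
        case True
        have "e 2 = 2 * exp (\<Delta>\<^sup>2 / \<sigma>\<^sup>2)" by (simp add: e_def)
        with ternary_gauss_square_le[OF \<sigma> close(1)[OF B] close(2)[OF B]] 1 True
        show ?thesis by (auto simp: Z_def e2_def min_def numeral_2_eq_2)
      qed (use 1 in \<open>auto simp: Z_def\<close>)
    qed (auto simp: Z_nonneg)
  qed
  have "(\<integral>\<^sup>+ g. ennreal (P g ^ \<alpha> / Q g ^ (\<alpha> - 1)) \<partial>lborel) + ennreal (real \<alpha>) =
      (\<integral>\<^sup>+ g. ennreal (P g ^ \<alpha> / Q g ^ (\<alpha> - 1)) + ennreal (real \<alpha>) * ennreal (Q g) \<partial>lborel)"
    using int by (simp add: nn_integral_add nn_integral_cmult)
  also have "\<dots> \<le> (\<integral>\<^sup>+ g. ennreal (Q g) + ennreal (real \<alpha>) * ennreal (P g) +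
      (\<Sum>j = 2..\<alpha>. ennreal (real (\<alpha> choose j)) * ennreal (D j g)) \<partial>lborel)"
  proof (rule nn_integral_mono)
    fix g :: "real ^ 'p"
    have "ennreal (P g ^ \<alpha> / Q g ^ (\<alpha> - 1)) + ennreal (real \<alpha>) * ennreal (Q g) =
        ennreal (P g ^ \<alpha> / Q g ^ (\<alpha> - 1) + real \<alpha> * Q g)"
      using pos[of g] by (simp add: ennreal_mult')
    also have "\<dots> \<le> ennreal (Q g + real \<alpha> * P g + (\<Sum>j = 2..\<alpha>. real (\<alpha> choose j) * D j g))"
      unfolding D_def using pos \<alpha> by (intro ennreal_leI power_ratio_le_binomial) auto
    also have "\<dots> = ennreal (Q g) + ennreal (real \<alpha>) * ennreal (P g) +
      (\<Sum>j = 2..\<alpha>. ennreal (real (\<alpha> choose j)) * ennreal (D j g))"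
      using pos[of g] D_nonneg by (simp add: ennreal_mult'[symmetric] sum_ennreal sum_nonneg)
    finally show "ennreal (P g ^ \<alpha> / Q g ^ (\<alpha> - 1)) + ennreal (real \<alpha>) * ennreal (Q g) \<le> \<dots>" .
  qed
  also have "\<dots> = 1 + ennreal (real \<alpha>) +
      (\<Sum>j = 2..\<alpha>. ennreal (real (\<alpha> choose j)) * (\<integral>\<^sup>+ g. ennreal (D j g) \<partial>lborel))"
    using int by (simp add: nn_integral_add nn_integral_cmult nn_integral_sum)
  also have "\<dots> \<le> 1 + ennreal (real \<alpha>) + (\<Sum>j = 2..\<alpha>. ennreal (real (\<alpha> choose j)) * ennreal (q ^ j * Z j))"
    by (intro add_mono sum_mono mult_left_mono D_le) auto
  also have "(\<Sum>j = 2..\<alpha>. ennreal (real (\<alpha> choose j)) * ennreal (q ^ j * Z j)) =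
      ennreal (\<Sum>j = 2..\<alpha>. real (\<alpha> choose j) * (q ^ j * Z j))"
    using Z_nonneg by (subst sum_ennreal[symmetric]) (auto simp: ennreal_mult' q_def)
  also have "1 + ennreal (real \<alpha>) + ennreal (\<Sum>j = 2..\<alpha>. real (\<alpha> choose j) * (q ^ j * Z j)) =
     ennreal (1 + (\<Sum>j = 2..\<alpha>. real (\<alpha> choose j) * (q ^ j * Z j))) + ennreal (real \<alpha>)"
    using Z_nonneg by (simp add: sum_nonneg q_def add_ac)
  finally have "(\<integral>\<^sup>+ g. ennreal (P g ^ \<alpha> / Q g ^ (\<alpha> - 1)) \<partial>lborel) \<le>
      ennreal (1 + (\<Sum>j = 2..\<alpha>. real (\<alpha> choose j) * (q ^ j * Z j)))"
    by (simp add: add.commute[of _ "ennreal (real \<alpha>)"] ennreal_add_left_cancel_le)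
  also have "{2..\<alpha>} = insert 2 {3..\<alpha>}" using \<alpha> by auto
  also have "1 + (\<Sum>j\<in>insert 2 {3..\<alpha>}. real (\<alpha> choose j) * (q ^ j * Z j)) = subsampled_moment_bound q \<Delta> \<sigma> \<alpha>"
    by (auto simp: subsampled_moment_bound_def Z_def e2_def e_def mult_ac intro!: sum.cong)
  finally show ?thesis by (simp add: P_def Q_def q_def)
qed

section \<open>Dual form of the moment bound\<close>

lemma ennreal_power_le_cancel:
  assumes "x ^ Suc k \<le> ennreal (y ^ Suc k)" "y \<ge> 0"
  shows "x \<le> ennreal y"
proof (cases x)
  case (real r)
  then have "r ^ Suc k \<le> y ^ Suc k"
    using assms by (simp add: ennreal_power del: power_Suc)
  then show ?thesis
    using real assms power_le_imp_le_base[of r k y] by (auto intro: ennreal_leI)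
next
  case top
  then show ?thesis using assms by (simp add: top_unique del: power_Suc)
qed

text \<open>Hoelder's inequality with exponents \<open>k + 1\<close> and \<open>(k + 1) / k\<close>,
  raised to the power \<open>k + 1\<close> so that no fractional exponents occur. It is derived from
  \<open>young_power\<close> with a free scale \<open>t\<close> that is then optimized.\<close>

lemma nn_integral_holder_power:
  fixes \<phi> P Q :: "'a \<Rightarrow> real"
  assumes [measurable]: "\<phi> \<in> borel_measurable M" "P \<in> borel_measurable M" "Q \<in> borel_measurable M"
    and \<phi>: "\<And>x. 0 \<le> \<phi> x" and P: "\<And>x. 0 \<le> P x" and Q: "\<And>x. 0 < Q x" and k: "k > 0" and K: "K > 0"
    and moment: "(\<integral>\<^sup>+ x. ennreal (P x ^ Suc k / Q x ^ k) \<partial>M) \<le> ennreal K"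
    and fin: "(\<integral>\<^sup>+ x. ennreal (Q x * \<phi> x ^ Suc k) \<partial>M) < \<infinity>"
  shows "(\<integral>\<^sup>+ x. ennreal (P x * \<phi> x ^ k) \<partial>M) ^ Suc k \<le>
    (\<integral>\<^sup>+ x. ennreal (Q x * \<phi> x ^ Suc k) \<partial>M) ^ k * ennreal K"
proof -
  define B where "B = enn2real (\<integral>\<^sup>+ x. ennreal (Q x * \<phi> x ^ Suc k) \<partial>M)"
  have B: "(\<integral>\<^sup>+ x. ennreal (Q x * \<phi> x ^ Suc k) \<partial>M) = ennreal B"
    using fin by (simp add: B_def)
  have B0: "B \<ge> 0" by (simp add: B_def)
  show ?thesis
  \<comment> \<open>For \<open>B = 0\<close> no optimal scale exists; since \<open>Q\<close> is
    positive, \<phi> vanishes almost everywhere and, as \<open>k > 0\<close>, so does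
    \<open>\<phi> x ^ k\<close>.\<close>
  proof (cases "B = 0")
    case True
    then have "(\<integral>\<^sup>+ x. ennreal (Q x * \<phi> x ^ Suc k) \<partial>M) = 0"
      using B by simp
    then have "AE x in M. ennreal (Q x * \<phi> x ^ Suc k) = 0"
      by (subst (asm) nn_integral_0_iff_AE) auto
    then have "AE x in M. ennreal (P x * \<phi> x ^ k) = 0"
    proof eventually_elim
      case (elim x)
      have "\<phi> x = 0"
      proof (rule ccontr)
        assume "\<phi> x \<noteq> 0"
        then have "Q x * \<phi> x ^ Suc k > 0" using \<phi>[of x] Q[of x] by simp
        with elim show False by (simp add: ennreal_eq_0_iff)
      qed
      then show ?case using k by (simp add: power_0_left)
    qed
    then have "(\<integral>\<^sup>+ x. ennreal (P x * \<phi> x ^ k) \<partial>M) = 0"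
      by (subst nn_integral_0_iff_AE) auto
    then show ?thesis by simp
  next
    case False
    define b where "b = root (Suc k) B"
    define \<kappa> where "\<kappa> = root (Suc k) K"
    \<comment> \<open>The minimizer of \<open>k * t * B + K / t ^ k\<close>: it makes both
      \<open>t * B\<close> and \<open>K / t ^ k\<close> equal to
      \<open>\<kappa> * b ^ k\<close>.\<close>
    define t where "t = \<kappa> / b"
    have b: "b > 0" "b ^ Suc k = B"
      unfolding b_def using False B0 by (auto intro: real_root_gt_zero real_root_pow_pos2 simp del: power_Suc)
    have \<kappa>: "\<kappa> > 0" "\<kappa> ^ Suc k = K"
      unfolding \<kappa>_def using K by (auto intro: real_root_gt_zero real_root_pow_pos2 simp del: power_Suc)
    have t: "t > 0" using b \<kappa> by (simp add: t_def)
    have young: "real (Suc k) * (P x * \<phi> x ^ k) \<le>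
        real k * t * (Q x * \<phi> x ^ Suc k) + 1 / t ^ k * (P x ^ Suc k / Q x ^ k)" for x
    proof -
      \<comment> \<open>Young's inequality for \<open>t * \<phi> x\<close> and the likelihood ratio
        \<open>P x / Q x\<close>, weighted by \<open>Q x / t ^ k\<close>.\<close>
      have "Q x / t ^ k * (real (Suc k) * (t * \<phi> x) ^ k * (P x / Q x)) \<le>
          Q x / t ^ k * (real k * (t * \<phi> x) ^ Suc k + (P x / Q x) ^ Suc k)"
        using t Q[of x] P[of x] \<phi>[of x] by (intro mult_left_mono young_power) auto
      moreover have "Q x / t ^ k * (real (Suc k) * (t * \<phi> x) ^ k * (P x / Q x)) =
          real (Suc k) * (P x * \<phi> x ^ k)"
        using t Q[of x] by (simp add: power_mult_distrib)
      moreover have "Q x / t ^ k * (real k * (t * \<phi> x) ^ Suc k + (P x / Q x) ^ Suc k) =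
          real k * t * (Q x * \<phi> x ^ Suc k) + 1 / t ^ k * (P x ^ Suc k / Q x ^ k)"
        using t Q[of x] by (simp add: power_mult_distrib power_divide distrib_left)
      ultimately show ?thesis by simp
    qed
    have "ennreal (real (Suc k)) * (\<integral>\<^sup>+ x. ennreal (P x * \<phi> x ^ k) \<partial>M) =
        (\<integral>\<^sup>+ x. ennreal (real (Suc k) * (P x * \<phi> x ^ k)) \<partial>M)"
      by (simp add: nn_integral_cmult ennreal_mult' del: of_nat_Suc)
    also have "\<dots> \<le> (\<integral>\<^sup>+ x. ennreal (real k * t) * ennreal (Q x * \<phi> x ^ Suc k) +
        ennreal (1 / t ^ k) * ennreal (P x ^ Suc k / Q x ^ k) \<partial>M)"
    proof (rule nn_integral_mono)
      fix x
      have "ennreal (real (Suc k) * (P x * \<phi> x ^ k)) \<le>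
          ennreal (real k * t * (Q x * \<phi> x ^ Suc k) + 1 / t ^ k * (P x ^ Suc k / Q x ^ k))"
        by (intro ennreal_leI young)
      also have "\<dots> = ennreal (real k * t) * ennreal (Q x * \<phi> x ^ Suc k) +
          ennreal (1 / t ^ k) * ennreal (P x ^ Suc k / Q x ^ k)"
        using t Q[of x] P[of x] \<phi>[of x]
        by (subst ennreal_plus) (auto simp: ennreal_mult'[symmetric] simp del: power_Suc)
      finally show "ennreal (real (Suc k) * (P x * \<phi> x ^ k)) \<le> \<dots>" .
    qed
    also have "\<dots> = ennreal (real k * t) * ennreal B +
        ennreal (1 / t ^ k) * (\<integral>\<^sup>+ x. ennreal (P x ^ Suc k / Q x ^ k) \<partial>M)"
      by (simp add: nn_integral_add nn_integral_cmult B del: power_Suc)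
    also have "\<dots> \<le> ennreal (real k * t) * ennreal B + ennreal (1 / t ^ k) * ennreal K"
      by (intro add_mono mult_left_mono moment) auto
    also have "\<dots> = ennreal (real k * t * B + 1 / t ^ k * K)"
      using t B0 K by (subst ennreal_plus) (auto simp: ennreal_mult'[symmetric])
    also have "real k * t * B + 1 / t ^ k * K = real (Suc k) * (\<kappa> * b ^ k)"
      using b(1) \<kappa>(1) by (simp add: b(2)[symmetric] \<kappa>(2)[symmetric] t_def power_divide algebra_simps)
    also have "ennreal \<dots> = ennreal (real (Suc k)) * ennreal (\<kappa> * b ^ k)"
      by (rule ennreal_mult') simp
    finally have "(\<integral>\<^sup>+ x. ennreal (P x * \<phi> x ^ k) \<partial>M) \<le> ennreal (\<kappa> * b ^ k)"
      by (subst (asm) ennreal_mult_le_mult_iff) auto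
    then have "(\<integral>\<^sup>+ x. ennreal (P x * \<phi> x ^ k) \<partial>M) ^ Suc k \<le> ennreal (\<kappa> * b ^ k) ^ Suc k"
      by (rule power_mono_ennreal)
    also have "\<dots> = ennreal ((\<kappa> * b ^ k) ^ Suc k)"
      using \<kappa> b by (intro ennreal_power) auto
    also have "(\<kappa> * b ^ k) ^ Suc k = B ^ k * K"
      unfolding power_mult_distrib \<kappa>(2) b(2)[symmetric] power_mult[symmetric] by (simp add: mult_ac)
    also have "ennreal \<dots> = ennreal B ^ k * ennreal K"
      using B0 K by (simp add: ennreal_mult' ennreal_power)
    finally show ?thesis by (simp add: B del: power_Suc)
  qed
qed

text \<open>By Hoelder duality this says that \<open>dP/dQ\<close> exists and \<open>\<integral>(dP/dQ)\<^bsup>k+1\<^esup> dQ \<le> K\<close>, but stated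
  without densities it passes through push-forwards and kernel compositions for free.\<close>

definition moment_dominated :: "nat \<Rightarrow> real \<Rightarrow> 'a measure \<Rightarrow> 'a measure \<Rightarrow> bool" where
  "moment_dominated k K P Q \<longleftrightarrow>
    (\<forall>\<phi> N. \<phi> \<in> borel_measurable P \<longrightarrow> (\<forall>x. 0 \<le> \<phi> x \<and> \<phi> x \<le> N) \<longrightarrow>
      (\<integral>\<^sup>+ x. ennreal (\<phi> x ^ k) \<partial>P) ^ Suc k \<le> (\<integral>\<^sup>+ x. ennreal (\<phi> x ^ Suc k) \<partial>Q) ^ k * ennreal K)"

lemma moment_dominatedD:
  assumes "moment_dominated k K P Q" "\<phi> \<in> borel_measurable P" "\<And>x. 0 \<le> \<phi> x" "\<And>x. \<phi> x \<le> N"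
  shows "(\<integral>\<^sup>+ x. ennreal (\<phi> x ^ k) \<partial>P) ^ Suc k \<le> (\<integral>\<^sup>+ x. ennreal (\<phi> x ^ Suc k) \<partial>Q) ^ k * ennreal K"
  using assms unfolding moment_dominated_def by blast

text \<open>Post-processing: a bounded test function on the target pulls back to one on the source
  with the same bound.\<close>

lemma moment_dominated_distr:
  assumes "moment_dominated k K P Q" "sets P = sets Q" and f: "f \<in> measurable P N"
  shows "moment_dominated k K (distr P N f) (distr Q N f)"
  unfolding moment_dominated_def
proof (intro allI impI)
  note [measurable] = f
  have [measurable]: "f \<in> measurable Q N" using f measurable_cong_sets[OF assms(2) refl] by blast
  fix \<phi> :: "'b \<Rightarrow> real" and C assume [measurable]: "\<phi> \<in> borel_measurable (distr P N f)" and bd: "\<forall>x. 0 \<le> \<phi> x \<and> \<phi> x \<le> C"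
  have [measurable]: "\<phi> \<in> borel_measurable N" using \<open>\<phi> \<in> _\<close> by simp
  have "(\<integral>\<^sup>+ x. ennreal (\<phi> (f x) ^ k) \<partial>P) ^ Suc k \<le> (\<integral>\<^sup>+ x. ennreal (\<phi> (f x) ^ Suc k) \<partial>Q) ^ k * ennreal K"
    by (rule moment_dominatedD[OF assms(1), of _ C]) (use bd in auto)
  then show "(\<integral>\<^sup>+ x. ennreal (\<phi> x ^ k) \<partial>distr P N f) ^ Suc k \<le>
      (\<integral>\<^sup>+ x. ennreal (\<phi> x ^ Suc k) \<partial>distr Q N f) ^ k * ennreal K"
    by (simp add: nn_integral_distr del: power_Suc)
qed

text \<open>Adaptive composition. The inner domination bounds the conditional integral of
  \<open>\<phi> ^ k\<close> by a power of \<psi>, the conditional \<open>L^(k+1)\<close> norm of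
  \<phi> under \<open>q s\<close>. This \<psi> is again a test function, the outer domination
  applies to it, and integrating \<open>\<psi> ^ Suc k\<close> over \<open>Q\<close> restores the
  integral of \<open>\<phi> ^ Suc k\<close> over the composition.\<close>

lemma moment_dominated_bind:
  assumes PQ: "moment_dominated k K P Q" and sets: "sets P = sets Q" and ne: "space P \<noteq> {}"
    and p: "p \<in> measurable P (subprob_algebra N)" and q: "q \<in> measurable Q (subprob_algebra N)"
    and pq: "\<And>s. s \<in> space P \<Longrightarrow> moment_dominated k L (p s) (q s)" and L: "L \<ge> 0"
  shows "moment_dominated k (K * L) (P \<bind> p) (Q \<bind> q)"
  unfolding moment_dominated_def
proof (intro allI impI)
  fix \<phi> :: "'b \<Rightarrow> real" and C assume \<phi>: "\<phi> \<in> borel_measurable (P \<bind> p)" and "\<forall>x. 0 \<le> \<phi> x \<and> \<phi> x \<le> C"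
  then have bd: "0 \<le> \<phi> x" "\<phi> x \<le> C" for x by auto
  have C: "C \<ge> 0" using bd[of undefined] by linarith
  have space: "space P = space Q" using sets by (rule sets_eq_imp_space_eq)
  have sets_p: "sets (p s) = sets N" if "s \<in> space P" for s
    using measurable_space[OF p that] by (simp add: sets_eq_iff_bounded[of "p s" N] space_subprob_algebra)
  have "sets (P \<bind> p) = sets N" using sets_p ne by (rule sets_bind)
  then have \<phi>N [measurable]: "\<phi> \<in> borel_measurable N"
    using \<phi> measurable_cong_sets by blast
  define J where "J = (\<lambda>s. \<integral>\<^sup>+ x. ennreal (\<phi> x ^ Suc k) \<partial>q s)"
  \<comment> \<open>Test functions are bounded on the whole type, while \<open>J\<close> is
    controlled only on the space of \<open>Q\<close>; hence the value 0 elsewhere.\<close>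
  define \<psi> where "\<psi> = (\<lambda>s. if s \<in> space Q then root (Suc k) (enn2real (J s)) else 0)"
  define \<kappa> where "\<kappa> = root (Suc k) L"
  have \<kappa>: "\<kappa> \<ge> 0" "\<kappa> ^ Suc k = L" unfolding \<kappa>_def using L by (auto intro: real_root_pow_pos2 simp del: power_Suc)
  have J_meas: "J \<in> borel_measurable Q"
    unfolding J_def by (rule measurable_compose[OF q]) (auto intro!: nn_integral_measurable_subprob_algebra)
  then have \<psi>Q [measurable]: "\<psi> \<in> borel_measurable Q"
    unfolding \<psi>_def by (intro measurable_If_set) auto
  then have \<psi>P [measurable]: "\<psi> \<in> borel_measurable P" using measurable_cong_sets[OF sets refl] by blast
  \<comment> \<open>Subprobability kernels preserve the bound of \<phi>: this makes \<open>J\<close>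
    finite, so that \<open>enn2real\<close> loses nothing, and gives \<psi> the bound
    \<open>C\<close>.\<close>
  have J_le: "J s \<le> ennreal (C ^ Suc k)" if "s \<in> space Q" for s
  proof -
    interpret subprob_space "q s"
      using measurable_space[OF q that] by (simp add: space_subprob_algebra)
    have "J s \<le> (\<integral>\<^sup>+ x. ennreal (C ^ Suc k) \<partial>q s)"
      unfolding J_def using bd by (intro nn_integral_mono ennreal_leI power_mono) auto
    also have "\<dots> \<le> ennreal (C ^ Suc k) * 1"
      by (subst nn_integral_const, intro mult_left_mono emeasure_space_le_1) auto
    finally show ?thesis by simp
  qed
  have \<psi>_pow: "ennreal (\<psi> s ^ Suc k) = J s" if "s \<in> space Q" for s
  proof -
    have "\<psi> s ^ Suc k = enn2real (J s)"
      unfolding \<psi>_def using that by (auto intro: real_root_pow_pos2 simp del: power_Suc)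
    moreover have "J s < top" using J_le[OF that] by (rule le_less_trans) simp
    ultimately show ?thesis by simp
  qed
  have \<psi>0: "\<psi> s \<ge> 0" for s unfolding \<psi>_def by auto
  have \<psi>C: "\<psi> s \<le> C" for s
  proof (cases "s \<in> space Q")
    case True
    then have "ennreal (\<psi> s ^ Suc k) \<le> ennreal (C ^ Suc k)" using J_le \<psi>_pow by metis
    then have "\<psi> s ^ Suc k \<le> C ^ Suc k" using C by (simp add: ennreal_le_iff del: power_Suc)
    then show ?thesis using C by (rule power_le_imp_le_base)
  qed (use C in \<open>auto simp: \<psi>_def\<close>)
  have step: "(\<integral>\<^sup>+ x. ennreal (\<phi> x ^ k) \<partial>p s) \<le> ennreal (\<kappa> * \<psi> s ^ k)" if s: "s \<in> space P" for s
  proof (rule ennreal_power_le_cancel[of _ k])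
    have "\<phi> \<in> borel_measurable (p s)" using \<phi>N measurable_cong_sets[OF sets_p[OF s] refl] by blast
    then have "(\<integral>\<^sup>+ x. ennreal (\<phi> x ^ k) \<partial>p s) ^ Suc k \<le> J s ^ k * ennreal L"
      unfolding J_def using bd by (intro moment_dominatedD[OF pq[OF s]]) auto
    also have "\<dots> = ennreal ((\<psi> s ^ Suc k) ^ k) * ennreal L"
      using s space \<psi>_pow[of s] \<psi>0[of s] by (subst ennreal_power[symmetric]) auto
    also have "\<dots> = ennreal ((\<kappa> * \<psi> s ^ k) ^ Suc k)"
      unfolding power_mult_distrib \<kappa>(2) power_mult[symmetric]
      using \<psi>0[of s] L by (simp add: ennreal_mult'[symmetric] mult_ac)
    finally show "(\<integral>\<^sup>+ x. ennreal (\<phi> x ^ k) \<partial>p s) ^ Suc k \<le> ennreal ((\<kappa> * \<psi> s ^ k) ^ Suc k)" .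
  qed (use \<kappa> \<psi>0 in auto)
  have "(\<integral>\<^sup>+ x. ennreal (\<phi> x ^ k) \<partial>(P \<bind> p)) = (\<integral>\<^sup>+ s. \<integral>\<^sup>+ x. ennreal (\<phi> x ^ k) \<partial>p s \<partial>P)"
    by (rule nn_integral_bind[OF _ p]) measurable
  also have "\<dots> \<le> (\<integral>\<^sup>+ s. ennreal \<kappa> * ennreal (\<psi> s ^ k) \<partial>P)"
    using step \<kappa> \<psi>0 by (intro nn_integral_mono) (simp add: ennreal_mult')
  also have "\<dots> = ennreal \<kappa> * (\<integral>\<^sup>+ s. ennreal (\<psi> s ^ k) \<partial>P)"
    by (rule nn_integral_cmult) measurable
  finally have "(\<integral>\<^sup>+ x. ennreal (\<phi> x ^ k) \<partial>(P \<bind> p)) ^ Suc k \<le>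
      (ennreal \<kappa> * (\<integral>\<^sup>+ s. ennreal (\<psi> s ^ k) \<partial>P)) ^ Suc k"
    by (rule power_mono_ennreal)
  also have "\<dots> = ennreal L * (\<integral>\<^sup>+ s. ennreal (\<psi> s ^ k) \<partial>P) ^ Suc k"
    unfolding power_mult_distrib using \<kappa> by (simp only: ennreal_power)
  also have "\<dots> \<le> ennreal L * ((\<integral>\<^sup>+ s. ennreal (\<psi> s ^ Suc k) \<partial>Q) ^ k * ennreal K)"
    by (intro mult_left_mono moment_dominatedD[OF PQ \<psi>P \<psi>0 \<psi>C]) auto
  also have "(\<integral>\<^sup>+ s. ennreal (\<psi> s ^ Suc k) \<partial>Q) = (\<integral>\<^sup>+ s. J s \<partial>Q)"
    by (rule nn_integral_cong) (rule \<psi>_pow)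
  also have "\<dots> = (\<integral>\<^sup>+ x. ennreal (\<phi> x ^ Suc k) \<partial>(Q \<bind> q))"
    unfolding J_def by (rule nn_integral_bind[OF _ q, symmetric]) measurable
  finally show "(\<integral>\<^sup>+ x. ennreal (\<phi> x ^ k) \<partial>(P \<bind> p)) ^ Suc k \<le>
      (\<integral>\<^sup>+ x. ennreal (\<phi> x ^ Suc k) \<partial>(Q \<bind> q)) ^ k * ennreal (K * L)"
    using L by (simp add: ennreal_mult'' mult_ac del: power_Suc)
qed

text \<open>Return from the dual form. Indicators as test functions give absolute continuity;
  truncations of the density \<open>R\<close> give \<open>I n ^ Suc k \<le> I n ^ k * K\<close>,
  hence \<open>I n \<le> K\<close>, and monotone convergence removes the truncation.\<close>

lemma renyi_divergence_le_if_moment_dominated: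
  assumes Q: "prob_space Q" and sets: "sets P = sets Q"
    and dom: "moment_dominated k K P Q" and k: "k > 0" and K: "K \<ge> 1"
  shows "renyi_divergence (real (Suc k)) P Q \<le> ereal (ln K / real k)"
proof -
  interpret prob_space Q by fact
  have ac: "absolutely_continuous Q P"
    unfolding absolutely_continuous_def
  proof
    fix A assume A: "A \<in> null_sets Q"
    then have AP: "A \<in> sets P" using sets by auto
    have "(\<integral>\<^sup>+ x. ennreal (indicator A x ^ k) \<partial>P) ^ Suc k \<le>
        (\<integral>\<^sup>+ x. ennreal (indicator A x ^ Suc k) \<partial>Q) ^ k * ennreal K"
      using AP by (intro moment_dominatedD[OF dom, of _ 1]) (auto simp: indicator_def)
    moreover have "indicator A x ^ j = (indicator A x :: real)" if "j > 0" for j x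
      using that by (auto simp: indicator_def)
    ultimately have "emeasure P A ^ Suc k \<le> emeasure Q A ^ k * ennreal K"
      using AP A k by (simp add: ennreal_indicator null_setsD2 del: power_Suc)
    then have "emeasure P A = 0" using A k by (simp add: null_setsD1 power_0_left)
    then show "A \<in> null_sets P" using AP by auto
  qed
  define R where "R = (\<lambda>x. enn2real (RN_deriv Q P x))"
  define I where "I = (\<lambda>n. \<integral>\<^sup>+ x. ennreal (min (R x) (real n) ^ Suc k) \<partial>Q)"
  have [measurable]: "R \<in> borel_measurable Q" unfolding R_def by measurable
  have R0: "R x \<ge> 0" for x by (simp add: R_def)
  have I_le: "I n \<le> ennreal K" for n
  proof -
    have meas: "(\<lambda>x. min (R x) (real n)) \<in> borel_measurable P"
      unfolding measurable_cong_sets[OF sets refl] by measurable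
    \<comment> \<open>One of the \<open>k + 1\<close> truncated factors is enlarged to the full
      derivative, which turns the integral over \<open>Q\<close> into one over
      \<open>P\<close>.\<close>
    have "I n \<le> (\<integral>\<^sup>+ x. RN_deriv Q P x * ennreal (min (R x) (real n) ^ k) \<partial>Q)"
      unfolding I_def
    proof (rule nn_integral_mono)
      fix x
      have "ennreal (min (R x) (real n)) \<le> ennreal (R x)" by (intro ennreal_leI) simp
      \<comment> \<open>Only an inequality, because \<open>enn2real\<close> sends an infinite
        derivative to 0.\<close>
      also have "\<dots> \<le> RN_deriv Q P x"
        unfolding R_def by (cases "RN_deriv Q P x") auto
      finally show "ennreal (min (R x) (real n) ^ Suc k) \<le> RN_deriv Q P x * ennreal (min (R x) (real n) ^ k)"
        using R0[of x] by (simp add: ennreal_mult' mult_right_mono)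
    qed
    also have "\<dots> = (\<integral>\<^sup>+ x. ennreal (min (R x) (real n) ^ k) \<partial>density Q (RN_deriv Q P))"
      by (rule nn_integral_density[symmetric]) measurable
    also have "density Q (RN_deriv Q P) = P" by (rule density_RN_deriv[OF ac sets])
    finally have "I n ^ Suc k \<le> (\<integral>\<^sup>+ x. ennreal (min (R x) (real n) ^ k) \<partial>P) ^ Suc k"
      by (rule power_mono_ennreal)
    also have "(\<integral>\<^sup>+ x. ennreal (min (R x) (real n) ^ k) \<partial>P) ^ Suc k \<le> I n ^ k * ennreal K"
      unfolding I_def using R0 by (intro moment_dominatedD[OF dom meas, of "real n"]) auto
    finally have le: "I n ^ Suc k \<le> I n ^ k * ennreal K" .
    \<comment> \<open>Truncation makes \<open>I n\<close> finite, so the power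
      \<open>I n ^ k\<close> can be cancelled.\<close>
    have "I n \<le> (\<integral>\<^sup>+ x. ennreal (real n ^ Suc k) \<partial>Q)"
      unfolding I_def using R0 by (intro nn_integral_mono ennreal_leI power_mono) auto
    also have "\<dots> < top" by (simp add: emeasure_space_1)
    finally obtain r where r: "r \<ge> 0" "I n = ennreal r" by (cases "I n") auto
    have "r ^ Suc k \<le> r ^ k * K"
      using le r K by (simp add: ennreal_power ennreal_mult'[symmetric] del: power_Suc)
    then have "r \<le> K" using r K by (cases "r = 0") auto
    then show ?thesis using r by (simp add: ennreal_leI)
  qed
  have "I \<longlonglongrightarrow> (\<integral>\<^sup>+ x. ennreal (R x ^ Suc k) \<partial>Q)"
    unfolding I_def
  proof (rule nn_integral_LIMSEQ)
    show "incseq (\<lambda>n x. ennreal (min (R x) (real n) ^ Suc k))"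
      using R0 by (auto intro!: incseq_SucI le_funI ennreal_leI power_mono simp del: power_Suc)
    show "(\<lambda>n. ennreal (min (R x) (real n) ^ Suc k)) \<longlonglongrightarrow> ennreal (R x ^ Suc k)" for x
    proof (rule tendsto_eventually)
      obtain n0 where "R x \<le> real n0" using real_arch_simple by blast
      then show "\<forall>\<^sub>F n in sequentially. ennreal (min (R x) (real n) ^ Suc k) = ennreal (R x ^ Suc k)"
        by (intro eventually_sequentiallyI[of n0]) (auto simp: min_def)
    qed
  qed measurable
  then have le: "(\<integral>\<^sup>+ x. ennreal (R x ^ Suc k) \<partial>Q) \<le> ennreal K"
    by (rule LIMSEQ_le_const2) (use I_le in auto)
  define r where "r = enn2real (\<integral>\<^sup>+ x. ennreal (R x ^ Suc k) \<partial>Q)"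
  have r: "r \<ge> 0" "r \<le> K"
    using enn2real_mono[OF le] K by (auto simp: r_def)
  \<comment> \<open>In the case \<open>r = 0\<close> the logarithm takes its default value 0, which
    is at most \<open>ln K\<close> because \<open>K \<ge> 1\<close>.\<close>
  have "ln r \<le> ln K"
    using r K by (cases "r = 0") auto
  then have "ln r / real k \<le> ln K / real k" by (intro divide_right_mono) auto
  moreover have "(\<integral>\<^sup>+ x. ennreal (enn2real (RN_deriv Q P x) powr real (Suc k)) \<partial>Q) = ennreal r"
  proof -
    have "enn2real (RN_deriv Q P x) powr real (Suc k) = R x ^ Suc k" for x
      unfolding R_def by (rule powr_realpow') auto
    moreover have "(\<integral>\<^sup>+ x. ennreal (R x ^ Suc k) \<partial>Q) < top"
      using le by (rule le_less_trans) simp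
    ultimately show ?thesis by (simp add: r_def del: power_Suc of_nat_Suc)
  qed
  ultimately show ?thesis
    using sets ac r(1) unfolding renyi_divergence_def by (simp add: Let_def)
qed

section \<open>The algorithm\<close>

lemma continuous_on_soft_threshold:
  fixes f :: "'a :: topological_space \<Rightarrow> real ^ 'p"
  assumes "continuous_on S f" "t \<ge> 0"
  shows "continuous_on S (\<lambda>x. soft_threshold t (f x))"
proof -
  \<comment> \<open>For \<open>t \<ge> 0\<close> at most one summand is nonzero, so the case
    distinction becomes a sum of continuous functions.\<close>
  have "soft_threshold t w = (\<chi> i. max (w $ i - t) 0 + min (w $ i + t) 0)" for w :: "real ^ 'p"
    using assms(2) by (auto simp: soft_threshold_def vec_eq_iff)
  then show ?thesis using assms(1) by (auto intro!: continuous_intros)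
qed

text \<open>The part of a step that sees the data only through the noisy gradient \<open>g\<close>;
  given the state it is mere post-processing of \<open>g\<close>.\<close>

definition admm_update :: "real \<Rightarrow> real \<Rightarrow> real \<Rightarrow> (real ^ 'p) \<times> (real ^ 'p) \<times> (real ^ 'p) \<Rightarrow> real ^ 'p \<Rightarrow>
    (real ^ 'p) \<times> (real ^ 'p) \<times> (real ^ 'p)" where
  "admm_update lam \<rho> \<eta>k s g =
    (let x' = (1 / (\<rho> + 1 / \<eta>k)) *\<^sub>R (- g - snd (snd s) + \<rho> *\<^sub>R fst (snd s) + (1 / \<eta>k) *\<^sub>R fst s);
         z' = soft_threshold (lam / \<rho>) (x' + (1 / \<rho>) *\<^sub>R snd (snd s))
     in (x', z', snd (snd s) + \<rho> *\<^sub>R (x' - z')))"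

definition batch_gradient :: "(real ^ 'p \<Rightarrow> 'd \<Rightarrow> real ^ 'p) \<Rightarrow> nat \<Rightarrow> 'd list \<Rightarrow> real ^ 'p \<Rightarrow> nat set \<Rightarrow> real ^ 'p" where
  "batch_gradient grad m D x B = (1 / real m) *\<^sub>R (\<Sum>i\<in>B. grad x (D ! i))"

lemma ssadmm_step_eq_admm_update:
  "ssadmm_step D grad m lam \<rho> \<eta>k B \<gamma> s = admm_update lam \<rho> \<eta>k s (batch_gradient grad m D (fst s) B + \<gamma>)"
  by (cases s) (simp add: ssadmm_step_def admm_update_def batch_gradient_def Let_def)

lemma borel_measurable_admm_update:
  fixes f :: "'a \<Rightarrow> (real ^ 'p) \<times> (real ^ 'p) \<times> (real ^ 'p)"
  assumes "lam \<ge> 0" "\<rho> \<ge> 0" and [measurable]: "f \<in> borel_measurable M" "g \<in> borel_measurable M"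
  shows "(\<lambda>x. admm_update lam \<rho> \<eta>k (f x) (g x)) \<in> borel_measurable M"
proof -
  have "continuous_on UNIV (\<lambda>p. admm_update lam \<rho> \<eta>k (fst p) (snd p :: real ^ 'p))"
    unfolding admm_update_def Let_def using assms(1,2)
    by (intro continuous_intros continuous_on_soft_threshold) auto
  from borel_measurable_continuous_onI[OF this]
  have "(\<lambda>x. (\<lambda>p. admm_update lam \<rho> \<eta>k (fst p) (snd p)) (f x, g x)) \<in> borel_measurable M"
    by (rule measurable_compose[rotated]) measurable
  then show ?thesis by simp
qed

text \<open>\<open>nat set\<close> is uncountable, so a function of a batch is measurable jointly with other arguments
  only because the sum depends on the batch through countably many finite sets.\<close>

lemma borel_measurable_batch_gradient:
  fixes grad :: "real ^ 'p \<Rightarrow> 'd \<Rightarrow> real ^ 'p"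
  assumes cont: "\<And>d. continuous_on UNIV (\<lambda>x. grad x d)"
    and [measurable]: "b \<in> measurable M (count_space UNIV)" "f \<in> borel_measurable M"
  shows "(\<lambda>x. batch_gradient grad m D (f x) (b x)) \<in> borel_measurable M"
proof -
  \<comment> \<open>Code 0 collects all infinite sets, over which the sum defaults to 0; the shift
    by \<open>Suc\<close> keeps 0 free for them.\<close>
  define c where "c = (\<lambda>B :: nat set. if finite B then Suc (set_encode B) else 0)"
  define G where "G = (\<lambda>j x. if j = 0 then 0 else batch_gradient grad m D x (set_decode (j - 1)))"
  have meas: "(\<lambda>x. grad x d) \<in> borel_measurable borel" for d
    using cont by (rule borel_measurable_continuous_onI)
  have grad_meas [measurable]: "(\<lambda>x. grad (f x) d) \<in> borel_measurable M" for d
    by (rule measurable_compose[OF _ meas]) measurable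
  have G [measurable]: "(\<lambda>x. G j (f x)) \<in> borel_measurable M" for j
    by (cases "j = 0") (simp_all add: G_def batch_gradient_def)
  have cb: "(\<lambda>x. c (b x)) \<in> measurable M (count_space UNIV)"
    by (rule measurable_compose[of b M "count_space UNIV"]) auto
  have "batch_gradient grad m D x B = G (c B) x" for x B
    by (simp add: G_def c_def batch_gradient_def)
  then show ?thesis
    using measurable_compose_countable[of "\<lambda>j x. G j (f x)" M borel, OF G cb] by simp
qed

section \<open>The law of the noisy batch gradient\<close>

lemma gaussian_vec_eq: "gaussian_vec \<sigma> = density lborel (\<lambda>g. ennreal (gauss_density \<sigma> 0 g))"
  by (simp add: gaussian_vec_def prod_normal_density_eq_gauss_density)

lemma sets_gaussian_vec [measurable_cong, simp]: "sets (gaussian_vec \<sigma>) = sets borel"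
  by (simp add: gaussian_vec_def)

lemma prob_space_gaussian_vec:
  assumes "\<sigma> > 0"
  shows "prob_space (gaussian_vec \<sigma> :: (real ^ 'p) measure)"
proof
  show "emeasure (gaussian_vec \<sigma> :: (real ^ 'p) measure) (space (gaussian_vec \<sigma>)) = 1"
    using assms by (simp add: gaussian_vec_eq emeasure_density)
qed

definition sample_measure :: "nat \<Rightarrow> nat \<Rightarrow> real \<Rightarrow> (nat set \<times> (real ^ 'p)) measure" where
  "sample_measure n m \<sigma> = pair_measure (measure_pmf (pmf_of_set (batches n m))) (gaussian_vec \<sigma>)"

lemma prob_space_sample_measure:
  assumes "\<sigma> > 0"
  shows "prob_space (sample_measure n m \<sigma> :: (nat set \<times> (real ^ 'p)) measure)"
proof -
  interpret G: prob_space "gaussian_vec \<sigma> :: (real ^ 'p) measure"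
    by (rule prob_space_gaussian_vec[OF assms])
  interpret pair_prob_space "measure_pmf (pmf_of_set (batches n m))" "gaussian_vec \<sigma> :: (real ^ 'p) measure"
    by unfold_locales
  show ?thesis unfolding sample_measure_def by unfold_locales
qed

lemma sets_sample_measure [measurable_cong]:
  "sets (sample_measure n m \<sigma>) = sets (count_space UNIV \<Otimes>\<^sub>M borel)"
  unfolding sample_measure_def by (intro sets_pair_measure_cong) auto

text \<open>For a fixed batch the noise is translated to mean \<open>u B\<close>; averaging over the
  uniform batch produces the mixture.\<close>

lemma nn_integral_noisy_batch_gradient:
  fixes F :: "real ^ 'p \<Rightarrow> ennreal" and u :: "nat set \<Rightarrow> real ^ 'p"
  assumes F [measurable]: "F \<in> borel_measurable borel" and "\<sigma> > 0" "m \<le> n"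
    and meas: "(\<lambda>\<omega>. u (fst \<omega>) + snd \<omega>) \<in> borel_measurable (sample_measure n m \<sigma>)"
  shows "(\<integral>\<^sup>+ \<omega>. F (u (fst \<omega>) + snd \<omega>) \<partial>sample_measure n m \<sigma>) =
    (\<integral>\<^sup>+ g. ennreal (mixture_density \<sigma> n m u g) * F g \<partial>lborel)"
proof -
  interpret G: prob_space "gaussian_vec \<sigma> :: (real ^ 'p) measure"
    by (rule prob_space_gaussian_vec[OF assms(2)])
  have shift: "(\<integral>\<^sup>+ g. F (u B + g) \<partial>gaussian_vec \<sigma>) =
      (\<integral>\<^sup>+ g. ennreal (gauss_density \<sigma> (u B) g) * F g \<partial>lborel)" for B
  proof -
    have "(\<integral>\<^sup>+ g. F (u B + g) \<partial>gaussian_vec \<sigma>) =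
        (\<integral>\<^sup>+ g. ennreal (gauss_density \<sigma> (u B) (u B + g)) * F (u B + g) \<partial>lborel)"
      unfolding gaussian_vec_eq by (subst nn_integral_density) (auto simp: gauss_density_def)
    also have "\<dots> = (\<integral>\<^sup>+ g. ennreal (gauss_density \<sigma> (u B) g) * F g \<partial>lborel)"
      by (rule nn_integral_lborel_translate) measurable
    finally show ?thesis .
  qed
  have "(\<integral>\<^sup>+ \<omega>. F (u (fst \<omega>) + snd \<omega>) \<partial>sample_measure n m \<sigma>) =
      (\<integral>\<^sup>+ B. \<integral>\<^sup>+ g. F (u B + g) \<partial>gaussian_vec \<sigma> \<partial>measure_pmf (pmf_of_set (batches n m)))"
    using measurable_compose[OF meas F] unfolding sample_measure_def
    by (subst G.nn_integral_fst[symmetric]) auto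
  also have "\<dots> = (\<Sum>B\<in>batches n m. \<integral>\<^sup>+ g. F (u B + g) \<partial>gaussian_vec \<sigma>) / real (card (batches n m))"
    using batches_nonempty[OF assms(3)]
    by (simp add: nn_integral_pmf_of_set ennreal_of_nat_eq_real_of_nat)
  finally show ?thesis
    by (simp add: nn_integral_mixture_density_mult assms shift)
qed

section \<open>Sensitivity of the batch gradient\<close>

text \<open>The two sums share all terms from \<open>B - {i}\<close>; what remains is one gradient
  on each side, of norm at most \<open>C\<close>.\<close>

lemma norm_batch_gradient_diff_le:
  fixes grad :: "real ^ 'p \<Rightarrow> 'd \<Rightarrow> real ^ 'p"
  assumes bound: "\<And>x d. norm (grad x d) \<le> C" and fin: "finite B" and i: "i \<in> B" and l: "l = i \<or> l \<notin> B"
    and agree: "\<And>j. j \<in> B \<Longrightarrow> j \<noteq> i \<Longrightarrow> D ! j = D' ! j"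
  shows "norm (batch_gradient grad m D x B - batch_gradient grad m D' x (insert l (B - {i}))) \<le> 2 * C / real m"
proof -
  have "(\<Sum>j\<in>B. grad x (D ! j)) = grad x (D ! i) + (\<Sum>j\<in>B - {i}. grad x (D ! j))"
    using fin i by (rule sum.remove)
  also have "(\<Sum>j\<in>B - {i}. grad x (D ! j)) = (\<Sum>j\<in>B - {i}. grad x (D' ! j))"
    by (rule sum.cong) (auto simp: agree)
  finally have "(\<Sum>j\<in>B. grad x (D ! j)) = grad x (D ! i) + (\<Sum>j\<in>B - {i}. grad x (D' ! j))" .
  moreover have "(\<Sum>j\<in>insert l (B - {i}). grad x (D' ! j)) = grad x (D' ! l) + (\<Sum>j\<in>B - {i}. grad x (D' ! j))"
    using fin l by (intro sum.insert) auto
  ultimately have "batch_gradient grad m D x B - batch_gradient grad m D' x (insert l (B - {i})) =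
      (1 / real m) *\<^sub>R (grad x (D ! i) - grad x (D' ! l))"
    unfolding batch_gradient_def by (simp only: algebra_simps)
  also have "norm \<dots> = norm (grad x (D ! i) - grad x (D' ! l)) / real m"
    by simp
  also have "\<dots> \<le> (C + C) / real m"
    by (intro divide_right_mono norm_triangle_le_diff add_mono bound) auto
  finally show ?thesis by simp
qed

lemma norm_batch_gradient_swap_le:
  fixes grad :: "real ^ 'p \<Rightarrow> 'd \<Rightarrow> real ^ 'p"
  assumes "\<And>x d. norm (grad x d) \<le> C" "finite B" "i \<in> B" "\<And>j. j \<in> B \<Longrightarrow> j \<noteq> i \<Longrightarrow> D ! j = D' ! j"
  shows "norm (batch_gradient grad m D x B - batch_gradient grad m D' x (swap_index i B l)) \<le> 2 * C / real m"
proof (cases "l \<in> B")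
  case True
  \<comment> \<open>Keeping the batch is viewed as exchanging \<open>i\<close> for itself.\<close>
  then have "swap_index i B l = insert i (B - {i})" using assms(3) by (auto simp: swap_index_def)
  then show ?thesis using norm_batch_gradient_diff_le[of grad C B i i D D'] assms by auto
next
  case False
  then show ?thesis using norm_batch_gradient_diff_le[of grad C B i l D D'] assms
    by (auto simp: swap_index_def)
qed

lemma subsampled_moment_bound_ge_1:
  assumes "q \<ge> 0"
  shows "subsampled_moment_bound q \<Delta> \<sigma> \<alpha> \<ge> 1"
  unfolding subsampled_moment_bound_def using assms by (auto intro!: add_nonneg_nonneg sum_nonneg)

section \<open>The iteration as a Markov chain and its composition\<close>

locale ssadmm_setup =
  fixes grad :: "real ^ 'p \<Rightarrow> 'd \<Rightarrow> real ^ 'p" and C lam \<rho> \<sigma> :: real and n m :: nat and \<eta> :: "nat \<Rightarrow> real"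
  assumes cont: "\<And>d. continuous_on UNIV (\<lambda>x. grad x d)"
    and bound: "\<And>x d. norm (grad x d) \<le> C"
    and lam: "lam \<ge> 0" and \<rho>: "\<rho> \<ge> 0" and m: "1 \<le> m" "m \<le> n" and \<sigma>: "\<sigma> > 0"
begin

abbreviation step where
  "step D t \<omega> s \<equiv> ssadmm_step D grad m lam \<rho> (\<eta> t) (fst \<omega>) (snd \<omega>) s"

abbreviation iter where
  "iter D s0 \<omega> t \<equiv> ssadmm_iter D grad m lam \<rho> \<eta> s0 \<omega> t"

definition kernel where
  "kernel D t s = distr (sample_measure n m \<sigma>) borel (\<lambda>\<omega>. step D t \<omega> s)"

text \<open>The law of the full state \<open>(x, z, y)\<close>, since only the triple evolves as a
  Markov chain; the output is projected at the end.\<close>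

definition trajectory_law where
  "trajectory_law D s0 t = distr (PiM {..<t} (\<lambda>_. sample_measure n m \<sigma>)) borel (\<lambda>\<omega>. iter D s0 \<omega> t)"

sublocale sample: prob_space "sample_measure n m \<sigma> :: (nat set \<times> (real ^ 'p)) measure"
  by (rule prob_space_sample_measure[OF \<sigma>])

sublocale samples: product_prob_space "\<lambda>_ :: nat. sample_measure n m \<sigma> :: (nat set \<times> (real ^ 'p)) measure" I for I
  by unfold_locales

lemma measurable_step:
  assumes [measurable]: "f \<in> measurable M (sample_measure n m \<sigma>)" "g \<in> borel_measurable M"
  shows "(\<lambda>x. step D t (f x) (g x)) \<in> borel_measurable M"
proof -
  have [measurable]: "f \<in> measurable M (count_space UNIV \<Otimes>\<^sub>M borel)"
    using assms(1) measurable_cong_sets[OF refl sets_sample_measure] by blast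
  have [measurable]: "fst \<in> borel \<rightarrow>\<^sub>M (borel :: (real ^ 'p) measure)"
    by (intro borel_measurable_continuous_onI continuous_intros)
  have [measurable]: "(\<lambda>x. fst (g x)) \<in> borel_measurable M" by measurable
  have [measurable]: "(\<lambda>x. fst (f x)) \<in> measurable M (count_space UNIV)" "(\<lambda>x. snd (f x)) \<in> borel_measurable M"
    by measurable
  show ?thesis
    unfolding ssadmm_step_eq_admm_update
    by (intro borel_measurable_admm_update lam \<rho> borel_measurable_add borel_measurable_batch_gradient cont) measurable
qed

text \<open>The index set stays fixed at \<open>t'\<close> while \<open>t\<close> grows, so that the
  induction remains on one product space.\<close>

lemma measurable_iter:
  assumes "t \<le> t'"
  shows "(\<lambda>\<omega>. iter D s0 \<omega> t) \<in> borel_measurable (PiM {..<t'} (\<lambda>_. sample_measure n m \<sigma>))"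
  using assms
proof (induction t)
  case (Suc t)
  have "(\<lambda>\<omega>. \<omega> t) \<in> measurable (PiM {..<t'} (\<lambda>_. sample_measure n m \<sigma>)) (sample_measure n m \<sigma>)"
    using Suc.prems by (intro measurable_component_singleton) auto
  then show ?case using Suc by (auto intro!: measurable_step)
qed auto

lemma measurable_kernel: "kernel D t \<in> measurable borel (subprob_algebra borel)"
  unfolding kernel_def
proof (rule measurable_distr2[where M = "sample_measure n m \<sigma>"])
  show "(\<lambda>(s, \<omega>). step D t \<omega> s) \<in> borel \<Otimes>\<^sub>M sample_measure n m \<sigma> \<rightarrow>\<^sub>M borel"
    unfolding case_prod_unfold by (rule measurable_step) measurable
  show "(\<lambda>_. sample_measure n m \<sigma> :: (nat set \<times> (real ^ 'p)) measure) \<in>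
      borel \<rightarrow>\<^sub>M subprob_algebra (sample_measure n m \<sigma>)"
    by (rule measurable_const) (auto simp: space_subprob_algebra intro: prob_space_imp_subprob_space sample.prob_space_axioms)
qed

lemma iter_fun_upd: "t' \<le> t \<Longrightarrow> iter D s0 (fun_upd \<omega> t w) t' = iter D s0 \<omega> t'"
  by (induction t') auto

text \<open>The state after \<open>t\<close> steps reads only samples below \<open>t\<close>, so
  sample \<open>t\<close> can be integrated out first, with the earlier ones fixed.\<close>

lemma trajectory_law_Suc: "trajectory_law D s0 (Suc t) = trajectory_law D s0 t \<bind> kernel D t"
proof (rule measure_eqI)
  have sets_kernel: "sets (kernel D t s) = sets borel" for s by (simp add: kernel_def)
  have kernel: "kernel D t \<in> measurable (trajectory_law D s0 t) (subprob_algebra borel)"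
    using measurable_kernel by (simp add: trajectory_law_def)
  have ne: "space (trajectory_law D s0 t) \<noteq> {}" by (simp add: trajectory_law_def)
  show "sets (trajectory_law D s0 (Suc t)) = sets (trajectory_law D s0 t \<bind> kernel D t)"
    using sets_bind[OF sets_kernel ne] by (simp add: trajectory_law_def)
  fix A assume "A \<in> sets (trajectory_law D s0 (Suc t))"
  then have A [measurable]: "A \<in> sets borel" by (simp add: trajectory_law_def)
  note iter_meas [measurable] = measurable_iter[OF order_refl]
  have [measurable]: "(\<lambda>\<omega>. step D t \<omega> s) \<in> sample_measure n m \<sigma> \<rightarrow>\<^sub>M borel" for s
    by (rule measurable_step) measurable
  have kernel_meas: "(\<lambda>s. emeasure (kernel D t s) A) \<in> borel_measurable borel"
    by (rule measurable_emeasure_kernel[OF measurable_kernel A])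
  have "emeasure (trajectory_law D s0 (Suc t)) A =
      (\<integral>\<^sup>+ \<omega>. indicator A (iter D s0 \<omega> (Suc t)) \<partial>PiM {..<Suc t} (\<lambda>_. sample_measure n m \<sigma>))"
    unfolding trajectory_law_def by (subst nn_integral_indicator[symmetric], simp)
      (subst nn_integral_distr, auto simp del: ssadmm_iter.simps)
  also have "\<dots> = (\<integral>\<^sup>+ \<omega>. (\<integral>\<^sup>+ w. indicator A (iter D s0 (fun_upd \<omega> t w) (Suc t)) \<partial>sample_measure n m \<sigma>)
      \<partial>PiM {..<t} (\<lambda>_. sample_measure n m \<sigma>))"
    unfolding lessThan_Suc
    by (rule samples.product_nn_integral_insert) (auto simp: lessThan_Suc[symmetric] simp del: ssadmm_iter.simps)
  also have "\<dots> = (\<integral>\<^sup>+ \<omega>. emeasure (kernel D t (iter D s0 \<omega> t)) A \<partial>PiM {..<t} (\<lambda>_. sample_measure n m \<sigma>))"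
  proof (rule nn_integral_cong)
    fix \<omega>
    show "(\<integral>\<^sup>+ w. indicator A (iter D s0 (fun_upd \<omega> t w) (Suc t)) \<partial>sample_measure n m \<sigma>) =
        emeasure (kernel D t (iter D s0 \<omega> t)) A"
      unfolding kernel_def by (subst nn_integral_indicator[symmetric], simp)
        (subst nn_integral_distr, auto simp: iter_fun_upd)
  qed
  also have "\<dots> = (\<integral>\<^sup>+ s. emeasure (kernel D t s) A \<partial>trajectory_law D s0 t)"
    unfolding trajectory_law_def using kernel_meas by (subst nn_integral_distr) auto
  also have "\<dots> = emeasure (trajectory_law D s0 t \<bind> kernel D t) A"
    by (rule emeasure_bind[OF ne kernel A, symmetric])
  finally show "emeasure (trajectory_law D s0 (Suc t)) A = emeasure (trajectory_law D s0 t \<bind> kernel D t) A" .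
qed

text \<open>For a fixed state both kernels push the mixture laws of the noisy gradients through the
  same \<open>admm_update\<close>. Pulling test functions back to gradient space reduces the claim
  to Hoelder's inequality with the moment bound of the mixtures.\<close>

lemma moment_dominated_kernel:
  assumes "neighboring n D D'" "\<alpha> \<ge> 2"
  shows "moment_dominated (\<alpha> - 1) (subsampled_moment_bound (real m / real n) (2 * C / real m) \<sigma> \<alpha>)
    (kernel D t s) (kernel D' t s)"
proof -
  define K where "K = subsampled_moment_bound (real m / real n) (2 * C / real m) \<sigma> \<alpha>"
  obtain k where k: "\<alpha> = Suc k" "k > 0" using assms(2) by (cases \<alpha>) auto
  obtain i where i: "i < n" and agree: "\<And>j. j < n \<Longrightarrow> j \<noteq> i \<Longrightarrow> D ! j = D' ! j"
    using assms(1) by (auto simp: neighboring_def)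
  define h where "h = (\<lambda>D. mixture_density \<sigma> n m (batch_gradient grad m D (fst s)))"
  have [measurable]: "h D \<in> borel_measurable borel" for D unfolding h_def by measurable
  have [measurable]: "admm_update lam \<rho> (\<eta> t) s \<in> borel \<rightarrow>\<^sub>M borel"
    by (rule borel_measurable_admm_update[OF lam \<rho>]) measurable
  have h_pos: "h D g > 0" for D g unfolding h_def by (rule mixture_density_pos[OF \<sigma> m(2)])
  have kernel: "(\<integral>\<^sup>+ s'. F s' \<partial>kernel D t s) = (\<integral>\<^sup>+ g. ennreal (h D g) * F (admm_update lam \<rho> (\<eta> t) s g) \<partial>lborel)"
    if [measurable]: "F \<in> borel_measurable borel" for F :: "_ \<Rightarrow> ennreal" and D
  proof -
    have [measurable]: "(\<lambda>\<omega>. step D t \<omega> s) \<in> sample_measure n m \<sigma> \<rightarrow>\<^sub>M borel"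
      by (rule measurable_step) measurable
    have grad_meas: "(\<lambda>\<omega>. batch_gradient grad m D (fst s) (fst \<omega>) + snd \<omega>) \<in> borel_measurable (sample_measure n m \<sigma>)"
      by (intro borel_measurable_add borel_measurable_batch_gradient cont) measurable
    have "(\<integral>\<^sup>+ s'. F s' \<partial>kernel D t s) = (\<integral>\<^sup>+ \<omega>. F (step D t \<omega> s) \<partial>sample_measure n m \<sigma>)"
      unfolding kernel_def by (rule nn_integral_distr) measurable
    also have "\<dots> = (\<integral>\<^sup>+ g. ennreal (h D g) * F (admm_update lam \<rho> (\<eta> t) s g) \<partial>lborel)"
      unfolding ssadmm_step_eq_admm_update h_def
      by (rule nn_integral_noisy_batch_gradient[OF _ \<sigma> m(2) grad_meas]) measurable
    finally show ?thesis .
  qed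
  have moment: "(\<integral>\<^sup>+ g. ennreal (h D g ^ \<alpha> / h D' g ^ (\<alpha> - 1)) \<partial>lborel) \<le> ennreal K"
    unfolding h_def K_def
  proof (rule subsampled_moment_le[OF \<sigma> m i assms(2)])
    fix B assume B: "B \<in> batches n m"
    then have sub: "B \<subseteq> {..<n}" and fin: "finite B" by (auto simp: batches_def intro: finite_subset)
    show "batch_gradient grad m D (fst s) B = batch_gradient grad m D' (fst s) B" if "i \<notin> B"
    proof -
      have "D ! j = D' ! j" if "j \<in> B" for j using that \<open>i \<notin> B\<close> sub by (intro agree) auto
      then show ?thesis by (simp add: batch_gradient_def)
    qed
    fix l assume iB: "i \<in> B" and "l < n"
    have "D ! j = D' ! j" if "j \<in> B" "j \<noteq> i" for j using that sub agree by auto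
    then show "norm (batch_gradient grad m D (fst s) B - batch_gradient grad m D' (fst s) (swap_index i B l)) \<le> 2 * C / real m"
      by (intro norm_batch_gradient_swap_le bound fin iB)
    \<comment> \<open>The sensitivity lemma with \<open>D'\<close> on both sides: only the exchanged
      record matters.\<close>
    show "norm (batch_gradient grad m D' (fst s) B - batch_gradient grad m D' (fst s) (swap_index i B l)) \<le> 2 * C / real m"
      by (intro norm_batch_gradient_swap_le bound fin iB refl)
  qed
  have K: "K > 0" using subsampled_moment_bound_ge_1[of "real m / real n" "2 * C / real m" \<sigma> \<alpha>]
    by (simp add: K_def)
  show ?thesis
    unfolding moment_dominated_def K_def[symmetric]
  proof (intro allI impI)
    fix \<phi> and N :: real assume "\<phi> \<in> borel_measurable (kernel D t s)" and "\<forall>x. 0 \<le> \<phi> x \<and> \<phi> x \<le> N"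
    then have [measurable]: "\<phi> \<in> borel_measurable borel" and bd: "\<And>x. 0 \<le> \<phi> x" "\<And>x. \<phi> x \<le> N"
      by (auto simp: kernel_def)
    define F where "F = (\<lambda>g. \<phi> (admm_update lam \<rho> (\<eta> t) s g))"
    have [measurable]: "F \<in> borel_measurable borel" unfolding F_def by measurable
    have F: "0 \<le> F g" "F g \<le> N" for g using bd by (auto simp: F_def)
    have int: "(\<integral>\<^sup>+ x. ennreal (\<phi> x ^ j) \<partial>kernel D t s) = (\<integral>\<^sup>+ g. ennreal (h D g * F g ^ j) \<partial>lborel)" for D j
      using h_pos by (subst kernel) (auto simp: F_def ennreal_mult' less_imp_le)
    \<comment> \<open>Boundedness of the test function supplies the finiteness condition of
      Hoelder's inequality.\<close>
    have "(\<integral>\<^sup>+ g. ennreal (h D' g * F g ^ Suc k) \<partial>lborel) \<le> (\<integral>\<^sup>+ g. ennreal (N ^ Suc k) * ennreal (h D' g) \<partial>lborel)"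
    proof (rule nn_integral_mono)
      fix g
      have "h D' g * F g ^ Suc k \<le> N ^ Suc k * h D' g"
        using F[of g] h_pos[of D' g] by (subst mult.commute) (intro mult_right_mono power_mono, auto)
      then show "ennreal (h D' g * F g ^ Suc k) \<le> ennreal (N ^ Suc k) * ennreal (h D' g)"
        using h_pos[of D' g] by (subst ennreal_mult''[symmetric]) (auto intro!: ennreal_leI simp del: power_Suc)
    qed
    also have "\<dots> = ennreal (N ^ Suc k)"
      unfolding h_def by (simp add: nn_integral_cmult nn_integral_mixture_density \<sigma> m del: power_Suc)
    also have "\<dots> < \<infinity>" by simp
    finally have "(\<integral>\<^sup>+ g. ennreal (h D g * F g ^ k) \<partial>lborel) ^ Suc k \<le>
        (\<integral>\<^sup>+ g. ennreal (h D' g * F g ^ Suc k) \<partial>lborel) ^ k * ennreal K"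
      using F h_pos k moment K by (intro nn_integral_holder_power) (auto simp: less_imp_le simp del: power_Suc)
    then show "(\<integral>\<^sup>+ x. ennreal (\<phi> x ^ (\<alpha> - 1)) \<partial>kernel D t s) ^ Suc (\<alpha> - 1) \<le>
        (\<integral>\<^sup>+ x. ennreal (\<phi> x ^ Suc (\<alpha> - 1)) \<partial>kernel D' t s) ^ (\<alpha> - 1) * ennreal K"
      by (simp add: int k del: power_Suc)
  qed
qed

lemma moment_dominated_trajectory_law:
  assumes "neighboring n D D'" "\<alpha> \<ge> 2"
  shows "moment_dominated (\<alpha> - 1) (subsampled_moment_bound (real m / real n) (2 * C / real m) \<sigma> \<alpha> ^ t)
    (trajectory_law D s0 t) (trajectory_law D' s0 t)"
proof (induction t)
  case 0
  \<comment> \<open>Before the first step both laws are the point mass at the initial state, and the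
    claim is an equality of powers with constant 1.\<close>
  have int: "(\<integral>\<^sup>+ x. F x \<partial>trajectory_law D s0 0) = F s0" if "F \<in> borel_measurable borel" for F D
    using that by (simp add: trajectory_law_def nn_integral_return)
  show ?case
    unfolding moment_dominated_def
  proof (intro allI impI)
    fix \<phi> and N :: real
    assume "\<phi> \<in> borel_measurable (trajectory_law D s0 0)" and bd: "\<forall>x. 0 \<le> \<phi> x \<and> \<phi> x \<le> N"
    then have [measurable]: "\<phi> \<in> borel_measurable borel" by (simp add: trajectory_law_def)
    have "(\<phi> s0 ^ (\<alpha> - 1)) ^ Suc (\<alpha> - 1) = (\<phi> s0 ^ Suc (\<alpha> - 1)) ^ (\<alpha> - 1)"
      unfolding power_mult[symmetric] by (simp only: mult.commute)
    moreover have "\<phi> s0 \<ge> 0" using bd by blast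
    ultimately show "(\<integral>\<^sup>+ x. ennreal (\<phi> x ^ (\<alpha> - 1)) \<partial>trajectory_law D s0 0) ^ Suc (\<alpha> - 1) \<le>
       (\<integral>\<^sup>+ x. ennreal (\<phi> x ^ Suc (\<alpha> - 1)) \<partial>trajectory_law D' s0 0) ^ (\<alpha> - 1) *
       ennreal (subsampled_moment_bound (real m / real n) (2 * C / real m) \<sigma> \<alpha> ^ 0)"
      by (simp add: int ennreal_power del: power_Suc)
  qed
next
  case (Suc t)
  have sets: "sets (trajectory_law D s0 t) = sets borel" for D by (simp add: trajectory_law_def)
  have kernel: "kernel E t \<in> measurable (trajectory_law D s0 t) (subprob_algebra borel)" for D E
    using measurable_kernel measurable_cong_sets[OF sets refl] by blast
  show ?case
    unfolding trajectory_law_Suc power_Suc2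
    using subsampled_moment_bound_ge_1[of "real m / real n" "2 * C / real m" \<sigma> \<alpha>]
    by (intro moment_dominated_bind[OF Suc _ _ kernel kernel] moment_dominated_kernel assms)
       (auto simp: trajectory_law_def)
qed

lemma ssadmm_eq_distr_trajectory_law:
  "ssadmm grad n m lam \<rho> T \<eta> \<sigma> x0 z0 y0 D = distr (trajectory_law D (x0, z0, y0) T) borel fst"
proof -
  have "fst \<in> borel \<rightarrow>\<^sub>M (borel :: (real ^ 'p) measure)"
    by (intro borel_measurable_continuous_onI continuous_intros)
  from distr_distr[OF this measurable_iter[OF order_refl]] show ?thesis
    by (simp add: ssadmm_def trajectory_law_def sample_measure_def comp_def)
qed

end

theorem theorem1:
  fixes f :: "real ^ 'p \<Rightarrow> 'd \<Rightarrow> real"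
    and grad :: "real ^ 'p \<Rightarrow> 'd \<Rightarrow> real ^ 'p"
    and C lam \<rho> \<sigma> :: real
    and n m T :: nat
    and \<eta> :: "nat \<Rightarrow> real"
    and x0 z0 y0 :: "real ^ 'p"
    and \<alpha> :: nat
  assumes grad: "\<And>x d. GDERIV (\<lambda>u. f u d) x :> grad x d"
    and cont: "\<And>d. continuous_on UNIV (\<lambda>x. grad x d)"
    and convex: "\<And>d. convex_on UNIV (\<lambda>x. f x d)"
    and bound: "\<And>x d. norm (grad x d) \<le> C"
    and C_pos: "C > 0"
    and lam_pos: "lam > 0" and rho_pos: "\<rho> > 0"
    and m_ge: "1 \<le> m" and m_le: "m \<le> n"
    and eta_pos: "\<And>k. k < T \<Longrightarrow> \<eta> k > 0"
    and sigma_pos: "\<sigma> > 0"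
    and alpha_ge: "\<alpha> \<ge> 2"
  shows "renyi_dp n (ssadmm grad n m lam \<rho> T \<eta> \<sigma> x0 z0 y0) (real \<alpha>)
           (real T * eps_prime C n m \<sigma> \<alpha>)"
proof -
  interpret ssadmm_setup grad C lam \<rho> \<sigma> n m \<eta>
    using assms by unfold_locales auto
  define K where "K = subsampled_moment_bound (real m / real n) (2 * C / real m) \<sigma> \<alpha>"
  have K: "K \<ge> 1" unfolding K_def by (rule subsampled_moment_bound_ge_1) simp
  obtain k where k: "\<alpha> = Suc k" "k > 0" using alpha_ge by (cases \<alpha>) auto
  \<comment> \<open>One factor \<open>K\<close> per iteration becomes, under the logarithm,
    \<open>T\<close> times the cost of a single step; \<open>k\<close> is
    \<open>\<alpha> - 1\<close>.\<close>
  have eps: "real T * eps_prime C n m \<sigma> \<alpha> = ln (K ^ T) / real k"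
  proof -
    have "eps_prime C n m \<sigma> \<alpha> = 1 / (real \<alpha> - 1) * ln K"
      by (simp add: eps_prime_def eps_j_def K_def subsampled_moment_bound_def Let_def mult_ac)
    then show ?thesis using K by (simp add: k ln_realpow)
  qed
  have fst: "fst \<in> borel \<rightarrow>\<^sub>M (borel :: (real ^ 'p) measure)"
    by (intro borel_measurable_continuous_onI continuous_intros)
  show ?thesis
    unfolding renyi_dp_def
  proof (intro allI impI)
    fix D D' :: "'d list" assume nb: "neighboring n D D'"
    let ?P = "\<lambda>D. distr (trajectory_law D (x0, z0, y0) T) borel fst"
    have fst': "fst \<in> trajectory_law D (x0, z0, y0) T \<rightarrow>\<^sub>M borel" for D
      using fst by (simp add: trajectory_law_def)
    have "prob_space (trajectory_law D (x0, z0, y0) T)" for D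
      unfolding trajectory_law_def by (rule samples.prob_space_distr[OF measurable_iter[OF order_refl]])
    then have "prob_space (?P D')" by (rule prob_space.prob_space_distr[OF _ fst'])
    moreover have "moment_dominated k (K ^ T) (?P D) (?P D')"
      using moment_dominated_trajectory_law[OF nb alpha_ge, of T] k
      by (intro moment_dominated_distr fst') (auto simp: K_def trajectory_law_def)
    ultimately have "renyi_divergence (real (Suc k)) (?P D) (?P D') \<le> ereal (ln (K ^ T) / real k)"
      using k K by (intro renyi_divergence_le_if_moment_dominated) (auto intro: one_le_power)
    then show "renyi_divergence (real \<alpha>) (ssadmm grad n m lam \<rho> T \<eta> \<sigma> x0 z0 y0 D)
        (ssadmm grad n m lam \<rho> T \<eta> \<sigma> x0 z0 y0 D') \<le> ereal (real T * eps_prime C n m \<sigma> \<alpha>)"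
      unfolding ssadmm_eq_distr_trajectory_law eps unfolding k(1) .
  qed
qed

end
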